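(* For every integer $t\geq 14$ and every real $\delta>0$ there is $\gamma=\gamma(t,\delta)\in(0,1]$ (depending only on $t$ and $\delta$) such that the following holds for all integers $k\ge t$ and $n\geq (t+1+\delta)k$ and every $\eta\in(0,1]$. If $\mathcal{A}$ and $\mathcal{B}$ are shifted cross $t$-intersecting families in $\binom{[n]}{k}$, then at least one of the following holds: (i) $\sqrt{|\mathcal{A}||\mathcal{B}|}<(1-\gamma\eta)\binom{n-t}{k-t}$; (ii) $|\mathcal{A}\bigtriangleup\mathcal{F}_0^t(n,k)|+|\mathcal{B}\bigtriangleup\mathcal{F}_0^t(n,k)|<\eta\binom{n-t}{k-t}$.
   Context: $[n]=\{1,\dots,n\}$, $\binom{[n]}{k}$ is the set of $k$-subsets of $[n]$. Families $\mathcal{A},\mathcal{B}$ are cross $t$-intersecting if $|A\cap B|\ge t$ for all $A\in\mathcal{A},B\in\mathcal{B}$. A family $\mathcal{A}$ of subsets of $[n]$ is shifted if whenever $1\le i<j\le n$, $A\in\mathcal{A}$ and $A\cap\{i,j\}=\{j\}$, then $(A\setminus\{j\})\cup\{i\}\in\mathcal{A}$. $\mathcal{F}_0^t(n,k)=\{F\in\binom{[n]}{k}:[t]\subset F\}$. $\bigtriangleup$ denotes symmetric difference. *)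

theory Defs
  imports Complex_Main "HOL-Library.Ramsey"
begin

text \<open>\<open>{1..n}\<close> stands for \<open>[n]\<close>, and \<open>nsets {1..n} k\<close> is the set of its \<open>k\<close>-subsets.\<close>

definition cross_intersecting :: "nat \<Rightarrow> nat set set \<Rightarrow> nat set set \<Rightarrow> bool" where
  "cross_intersecting t \<A> \<B> \<longleftrightarrow> (\<forall>A\<in>\<A>. \<forall>B\<in>\<B>. t \<le> card (A \<inter> B))"

definition shifted :: "nat \<Rightarrow> nat set set \<Rightarrow> bool" where
  "shifted n \<A> \<longleftrightarrow> \<A> \<subseteq> Pow {1..n} \<and>
     (\<forall>i j A. 1 \<le> i \<and> i < j \<and> j \<le> n \<and> A \<in> \<A> \<and> A \<inter> {i, j} = {j}
        \<longrightarrow> (A - {j}) \<union> {i} \<in> \<A>)"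

definition F0 :: "nat \<Rightarrow> nat \<Rightarrow> nat \<Rightarrow> nat set set" where
  "F0 t n k = {F \<in> nsets {1..n} k. {1..t} \<subseteq> F}"

end

(*
The argument is the pushing method of Ahlswede and Khachatrian, applied to a product of two families.
Represent the families by shifted up-sets G, H in [m] (initially m = 2k - t) and call E in G critical
if m is in E and E - {m} is not in G. A critical E and a critical F with |E Int F| = t cover [m], so
|E| + |F| = m + t. Hence for i + j = m + t one may delete the critical i-sets E from G while adding
F - {m} to H for all critical j-sets F, or do this with the roles of G and H interchanged, and the pair
remains cross t-intersecting. The critical i-sets account for a share X <= i/m of the first family, by
shifting, and the critical j-sets for a share Y <= j/m of the second. The product of the two sizes is
multiplied by (1 - X)(1 + rY) or by (1 - Y)(1 + r'X), where r and r' are at least t - 1, and the sum of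
these factors exceeds 2 + c(rY + r'X), except when i = t or j = t, where one family is {[m]} and the
density assumption gives a gain, and when m = t + 2, i = j = t + 1, where either both families lie in
{A. |A Int [t+2]| >= t + 1}, whose size is a constant factor below that of the star, or [t] generates
one family and the other one is small. When no critical set is left, m decreases; the process ends at
m = t with two full stars.
Each step multiplies the product by at least 1 + c times the relative size of the change, so the
deviation from the stars is bounded linearly by the loss in the product.
*)
theory Submission
  imports Defs
begin

subsection \<open>Stability under an exchange\<close>

text \<open>Linear stability: the product falls short of the square of \<open>card F\<close> by at
  least \<open>\<kappa>\<close> times the relative total deviation from \<open>F\<close>. Because of
  the cap at 1, a product below \<open>1 - \<kappa>\<close> times that square is stable whatever the
  deviation.\<close>

definition stable :: "real \<Rightarrow> 'a set \<Rightarrow> 'a set \<Rightarrow> 'a set \<Rightarrow> bool" where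
  "stable \<kappa> F A B \<longleftrightarrow> real (card A) * real (card B) \<le>
     (1 - \<kappa> * min 1 ((real (card (sym_diff A F)) + real (card (sym_diff B F))) / real (card F)))
       * (real (card F))\<^sup>2"

lemma stable_commute: "stable \<kappa> F A B \<longleftrightarrow> stable \<kappa> F B A"
  unfolding stable_def by (simp add: mult.commute add.commute)

lemma card_sym_diff_triangle:
  assumes "finite A" "finite B" "finite C"
  shows "card (sym_diff A C) \<le> card (sym_diff A B) + card (sym_diff B C)"
proof -
  have "card (sym_diff A C) \<le> card (sym_diff A B \<union> sym_diff B C)"
    using assms by (intro card_mono) auto
  then show ?thesis
    using card_Un_le[of "sym_diff A B" "sym_diff B C"] by linarith
qed

lemma card_le_card_add_sym_diff:
  assumes "finite A" "finite F"
  shows "card A \<le> card F + card (sym_diff A F)"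
proof -
  have "card A \<le> card (F \<union> sym_diff A F)"
    using assms by (intro card_mono) auto
  then show ?thesis
    using card_Un_le[of F "sym_diff A F"] by linarith
qed

lemma stable_if_product_le:
  assumes "real (card A) * real (card B) \<le> (1 - \<kappa>) * (real (card F))\<^sup>2" "0 \<le> \<kappa>"
  shows "stable \<kappa> F A B"
proof -
  have "\<kappa> * min 1 x \<le> \<kappa>" for x
    using assms(2) by (simp add: mult_left_le)
  then have "(1 - \<kappa>) * (real (card F))\<^sup>2 \<le> (1 - \<kappa> * min 1 x) * (real (card F))\<^sup>2" for x
    by (intro mult_right_mono) auto
  then show ?thesis
    unfolding stable_def using assms(1) order_trans by blast
qed

text \<open>It suffices that \<open>1 - \<kappa> * w' \<le> (1 - \<kappa> * (w' + s)) * (1 + c *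
  s)\<close>. Expanded, and up to the factor \<open>s\<close>, this asks for
  \<open>\<kappa> \<le> c * (1 - \<kappa> * (w' + s))\<close>; as \<open>w' + s \<le> 2\<close>, the
  bound \<open>\<kappa> * (1 + 2 * c) \<le> c\<close> is enough.\<close>

lemma gain_step:
  fixes P P' :: real
  assumes P: "0 \<le> P" "(1 + c * s) * P \<le> P'" and P': "P' \<le> (1 - \<kappa> * w') * Q"
    and "0 \<le> Q" "0 \<le> s" "s \<le> 1" "0 \<le> w'" "w' \<le> 1" "w \<le> w' + s"
    and c: "0 \<le> c" "0 \<le> \<kappa>" "\<kappa> \<le> c / (1 + 2 * c)"
  shows "P \<le> (1 - \<kappa> * w) * Q"
proof -
  have "\<kappa> * (1 + 2 * c) \<le> c"
    using c by (simp add: pos_le_divide_eq)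
  moreover have "c * (\<kappa> * (w' + s)) \<le> c * (\<kappa> * 2)"
    using assms by (intro mult_left_mono) auto
  ultimately have "\<kappa> \<le> c * (1 - \<kappa> * (w' + s))"
    by (simp add: algebra_simps)
  then have "s * \<kappa> \<le> s * (c * (1 - \<kappa> * (w' + s)))"
    using \<open>0 \<le> s\<close> mult_left_mono by blast
  then have "1 - \<kappa> * w' \<le> (1 - \<kappa> * (w' + s)) * (1 + c * s)"
    by (simp add: algebra_simps)
  then have "(1 + c * s) * P \<le> ((1 - \<kappa> * (w' + s)) * (1 + c * s)) * Q"
    using P(2) P' \<open>0 \<le> Q\<close> by (meson mult_right_mono order_trans)
  then have "(1 + c * s) * P \<le> (1 + c * s) * ((1 - \<kappa> * (w' + s)) * Q)"
    by (simp add: mult_ac)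
  moreover have "0 < 1 + c * s"
    using c \<open>0 \<le> s\<close> by (simp add: add_pos_nonneg)
  ultimately have "P \<le> (1 - \<kappa> * (w' + s)) * Q"
    by (simp add: mult_le_cancel_left_pos)
  also have "\<dots> \<le> (1 - \<kappa> * w) * Q"
    using assms by (intro mult_right_mono diff_left_mono mult_left_mono) auto
  finally show ?thesis .
qed

text \<open>The gain is relative to \<open>A\<close> and \<open>B\<close>, the deviation relative to
  \<open>F\<close>. If the new pair deviates by at least \<open>card F\<close>, its own loss already
  suffices. Otherwise the sizes are bounded in terms of \<open>card F\<close>, and
  \<open>gain_step\<close> applies with \<open>c / 4\<close>.\<close>

lemma stable_exchange:
  assumes fin: "finite A" "finite B'" "finite F"
    and sub: "A' \<subseteq> A" "B \<subseteq> B'" and ne: "A \<noteq> {}" "B \<noteq> {}" "F \<noteq> {}"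
    and gain: "(1 + c * (real (card (A - A')) / real (card A) + real (card (B' - B)) / real (card B)))
                 * (real (card A) * real (card B)) \<le> real (card A') * real (card B')"
    and stab: "stable \<kappa> F A' B'"
    and c: "0 \<le> c" "0 \<le> \<kappa>" "\<kappa> \<le> (c / 4) / (1 + 2 * (c / 4))"
  shows "stable \<kappa> F A B"
proof -
  define M where "M = real (card F)"
  define D where "D = real (card (sym_diff A F)) + real (card (sym_diff B F))"
  define D' where "D' = real (card (sym_diff A' F)) + real (card (sym_diff B' F))"
  define a where "a = real (card A)"
  define b where "b = real (card B)"
  define x where "x = real (card (A - A'))"
  define z where "z = real (card (B' - B))"
  have fin': "finite A'" "finite B"
    using fin sub finite_subset by blast+
  have pos: "0 < M" "0 < a" "0 < b"
    using fin fin' ne by (auto simp: M_def a_def b_def card_gt_0_iff)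
  have nn: "0 \<le> x" "0 \<le> z" "0 \<le> D'"
    by (auto simp: x_def z_def D'_def)
  have "sym_diff A A' = A - A'" "sym_diff B B' = B' - B"
    using sub by auto
  then have "D \<le> D' + (x + z)"
    using card_sym_diff_triangle[of A A' F] card_sym_diff_triangle[of B B' F] fin fin'
    unfolding D_def D'_def x_def z_def by simp
  then have DM: "D / M \<le> D' / M + (x + z) / M"
    using pos by (simp flip: add_divide_distrib add: divide_right_mono)
  have g0: "0 \<le> c * (x / a + z / b)"
    using c pos nn by simp
  have gain': "(1 + c * (x / a + z / b)) * (a * b) \<le> real (card A') * real (card B')"
    using gain by (simp add: x_def z_def a_def b_def)
  have st: "real (card A') * real (card B') \<le> (1 - \<kappa> * min 1 (D' / M)) * M\<^sup>2"
    using stab by (simp add: stable_def D'_def M_def)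
  have "a * b \<le> (1 - \<kappa> * min 1 (D / M)) * M\<^sup>2"
  proof (cases "D' < M")
    case True
    define s where "s = min 1 ((x + z) / M)"
    have "real (card A') < 2 * M" "real (card B') < 2 * M"
      using card_le_card_add_sym_diff[of A' F] card_le_card_add_sym_diff[of B' F] fin fin' True
      by (auto simp: M_def D'_def)
    moreover have "b \<le> real (card B')"
      using sub fin by (simp add: b_def card_mono)
    ultimately have bM: "b \<le> 4 * M"
      using pos by linarith
    have "c / 4 * s \<le> c * (x / a + z / b)"
    \<comment> \<open>If \<open>A\<close> loses at least half of its sets, the relative change is at
      least 1/2. Otherwise \<open>card A\<close> is less than twice \<open>card A'\<close>, hence
      below \<open>4 * M\<close>, and both relative changes are at least a quarter of those measured
      in \<open>M\<close>.\<close>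
    proof (cases "a \<le> 2 * x")
      case True
      then have "1 / 2 \<le> x / a" "0 \<le> z / b"
        using pos nn by (auto simp: field_simps)
      moreover have "s \<le> 1"
        by (simp add: s_def)
      ultimately have "s / 4 \<le> x / a + z / b"
        by linarith
      then show ?thesis
        using mult_left_mono[of "s / 4" "x / a + z / b" c] c by simp
    next
      case False
      moreover have "x = a - real (card A')"
        using sub fin' fin by (simp add: x_def a_def card_Diff_subset card_mono of_nat_diff)
      ultimately have "a \<le> 4 * M"
        using \<open>real (card A') < 2 * M\<close> by linarith
      then have "x / (4 * M) \<le> x / a" "z / (4 * M) \<le> z / b"
        using nn pos bM by (auto intro!: divide_left_mono)
      moreover have "x / (4 * M) = x / M / 4" "z / (4 * M) = z / M / 4"
        by simp_all
      moreover have "s \<le> x / M + z / M"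
        by (simp add: s_def add_divide_distrib)
      ultimately have "s / 4 \<le> x / a + z / b"
        by linarith
      then show ?thesis
        using mult_left_mono[of "s / 4" "x / a + z / b" c] c by simp
    qed
    then have "(1 + c / 4 * s) * (a * b) \<le> (1 + c * (x / a + z / b)) * (a * b)"
      using pos by (intro mult_right_mono) auto
    with gain' have "(1 + c / 4 * s) * (a * b) \<le> real (card A') * real (card B')"
      by linarith
    moreover have "0 \<le> s" "s \<le> 1" "0 \<le> min 1 (D' / M)" "min 1 (D' / M) \<le> 1"
      using pos nn by (auto simp: s_def)
    moreover have "min 1 (D / M) \<le> min 1 (D' / M) + s"
    proof -
      have "min 1 p \<le> min 1 q + min 1 r" if "p \<le> q + r" "0 \<le> q" "0 \<le> r" for p q r :: real
        using that by linarith
      moreover have "0 \<le> D' / M" "0 \<le> (x + z) / M"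
        using pos nn by simp_all
      ultimately show ?thesis
        using DM by (simp add: s_def)
    qed
    ultimately show ?thesis
      using gain_step[of "a * b" "c / 4" s "real (card A') * real (card B')" \<kappa> "min 1 (D' / M)" "M\<^sup>2"
          "min 1 (D / M)"] st c pos by simp
  next
    case False
    then have "min 1 (D' / M) = 1"
      using pos by simp
    moreover have "1 * (a * b) \<le> (1 + c * (x / a + z / b)) * (a * b)"
      using g0 pos by (intro mult_right_mono) auto
    ultimately have "a * b \<le> (1 - \<kappa>) * M\<^sup>2"
      using gain' st by simp
    moreover have "\<kappa> * min 1 (D / M) \<le> \<kappa>"
      using c by (simp add: mult_left_le)
    then have "(1 - \<kappa>) * M\<^sup>2 \<le> (1 - \<kappa> * min 1 (D / M)) * M\<^sup>2"
      by (intro mult_right_mono) auto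
    ultimately show ?thesis
      by linarith
  qed
  then show ?thesis
    by (simp add: stable_def D_def M_def a_def b_def)
qed

text \<open>An exchange that removes nothing multiplies the product by exactly 1 plus the relative
  increase, so \<open>stable_exchange\<close> applies with \<open>c = 1\<close>; its threshold is
  then (1/4) / (1 + 2/4) = 1/6.\<close>

lemma stable_enlarge:
  assumes "finite A" "finite B'" "finite F" "B \<subseteq> B'" "F \<noteq> {}"
    and stab: "stable \<kappa> F A B'" and \<kappa>: "0 \<le> \<kappa>" "\<kappa> \<le> 1 / 6"
  shows "stable \<kappa> F A B"
proof (cases "A = {} \<or> B = {}")
  case True
  then show ?thesis
    using \<kappa> by (intro stable_if_product_le) auto
next
  case False
  have "card (B' - B) = card B' - card B" "card B \<le> card B'" "card B > 0"
    using assms False finite_subset[of B B'] by (auto simp: card_Diff_subset card_mono card_gt_0_iff)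
  then have gain: "(1 + 1 * (real (card (A - A)) / real (card A) + real (card (B' - B)) / real (card B)))
      * (real (card A) * real (card B)) = real (card A) * real (card B')"
    by (simp add: of_nat_diff diff_divide_distrib)
  from False have "A \<noteq> {}" "B \<noteq> {}"
    by auto
  from stable_exchange[OF assms(1-3) order_refl assms(4) this assms(5) eq_refl[OF gain] stab]
  show ?thesis
    using \<kappa> by simp
qed

subsection \<open>Critical sets of shifted up-sets\<close>

definition shifted_upset :: "nat \<Rightarrow> nat set set \<Rightarrow> bool" where
  "shifted_upset m \<G> \<longleftrightarrow> shifted m \<G> \<and> (\<forall>E\<in>\<G>. \<forall>F. E \<subseteq> F \<and> F \<subseteq> {1..m} \<longrightarrow> F \<in> \<G>)"

text \<open>In an up-set of subsets of \<open>{1..m}\<close> without such sets, membership does not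
  depend on \<open>m\<close>; they are what prevents replacing \<open>m\<close> by
  \<open>m - 1\<close>.\<close>

definition critical :: "nat \<Rightarrow> nat set set \<Rightarrow> nat set set" where
  "critical m \<G> = {E \<in> \<G>. m \<in> E \<and> E - {m} \<notin> \<G>}"

definition critical_at :: "nat \<Rightarrow> nat \<Rightarrow> nat set set \<Rightarrow> nat set set" where
  "critical_at m i \<G> = {E \<in> critical m \<G>. card E = i}"

definition lower :: "nat \<Rightarrow> nat \<Rightarrow> nat set set \<Rightarrow> nat set set" where
  "lower m i \<G> = \<G> \<union> (\<lambda>E. E - {m}) ` critical_at m i \<G>"

lemma shiftedD:
  assumes "shifted n \<G>" "E \<in> \<G>" "j \<in> E" "i \<notin> E" "1 \<le> i" "i < j"
  shows "insert i (E - {j}) \<in> \<G>"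
proof -
  have "j \<le> n" "E \<inter> {i, j} = {j}"
    using assms by (fastforce simp: shifted_def)+
  then have "(E - {j}) \<union> {i} \<in> \<G>"
    using assms unfolding shifted_def by blast
  then show ?thesis
    by simp
qed

lemma shifted_upset_subset: "shifted_upset m \<G> \<Longrightarrow> E \<in> \<G> \<Longrightarrow> E \<subseteq> {1..m}"
  by (auto simp: shifted_upset_def shifted_def)

lemma shifted_upset_superset:
  "shifted_upset m \<G> \<Longrightarrow> E \<in> \<G> \<Longrightarrow> E \<subseteq> F \<Longrightarrow> F \<subseteq> {1..m} \<Longrightarrow> F \<in> \<G>"
  by (auto simp: shifted_upset_def)

lemma shifted_upset_shift:
  "shifted_upset m \<G> \<Longrightarrow> E \<in> \<G> \<Longrightarrow> j \<in> E \<Longrightarrow> i \<notin> E \<Longrightarrow> 1 \<le> i \<Longrightarrow> i < j \<Longrightarrow> insert i (E - {j}) \<in> \<G>"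
  using shiftedD by (auto simp: shifted_upset_def)

lemma shifted_upset_finite: "shifted_upset m \<G> \<Longrightarrow> finite \<G>"
  unfolding shifted_upset_def shifted_def using finite_subset finite_Pow_iff finite_atLeastAtMost by metis

lemma card_shift: "finite E \<Longrightarrow> j \<in> E \<Longrightarrow> i \<notin> E \<Longrightarrow> card (insert i (E - {j})) = card E"
  using card_Suc_Diff1[of E j] by simp

lemma shifted_upsetI:
  assumes "\<And>E. E \<in> \<G> \<Longrightarrow> E \<subseteq> {1..m}"
    and "\<And>E F. E \<in> \<G> \<Longrightarrow> E \<subseteq> F \<Longrightarrow> F \<subseteq> {1..m} \<Longrightarrow> F \<in> \<G>"
    and "\<And>E i j. E \<in> \<G> \<Longrightarrow> j \<in> E \<Longrightarrow> i \<notin> E \<Longrightarrow> 1 \<le> i \<Longrightarrow> i < j \<Longrightarrow> insert i (E - {j}) \<in> \<G>"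
  shows "shifted_upset m \<G>"
  unfolding shifted_upset_def shifted_def
proof (intro conjI allI impI ballI)
  fix i j A
  assume "1 \<le> i \<and> i < j \<and> j \<le> m \<and> A \<in> \<G> \<and> A \<inter> {i, j} = {j}"
  then have "insert i (A - {j}) \<in> \<G>"
    by (intro assms(3)) auto
  then show "A - {j} \<union> {i} \<in> \<G>"
    by simp
qed (use assms in auto)

lemma critical_at_subset: "critical_at m i \<G> \<subseteq> \<G>"
  by (auto simp: critical_at_def critical_def)

text \<open>Hence critical sets form an antichain, so deleting those of one size leaves an up-set.\<close>
lemma critical_superset:
  assumes \<G>: "shifted_upset m \<G>" and E: "E \<in> \<G>" "m \<in> E" "E \<subset> F" "F \<subseteq> {1..m}"
  shows "F - {m} \<in> \<G>"
proof -
  obtain l where l: "l \<in> F" "l \<notin> E"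
    using E by auto
  then have "l < m" "1 \<le> l"
    using E by (auto simp: order.order_iff_strict)
  then have "insert l (E - {m}) \<in> \<G>"
    using shifted_upset_shift[OF \<G> E(1,2) l(2)] by simp
  moreover have "insert l (E - {m}) \<subseteq> F - {m}"
    using E l by auto
  ultimately show ?thesis
    using shifted_upset_superset[OF \<G>] E by blast
qed

text \<open>For shifts, let a shift of \<open>E\<close> be critical of size \<open>i\<close>. Then
  \<open>m\<close> is in \<open>E\<close> and is not the element moved. Were \<open>E - {m}\<close>
  in \<open>\<G>\<close>, shifting it would show that the shift of \<open>E\<close> is not critical.
  So \<open>E\<close> is critical of the same size and has been deleted as well.\<close>

lemma shifted_upset_remove:
  assumes \<G>: "shifted_upset m \<G>"
  shows "shifted_upset m (\<G> - critical_at m i \<G>)"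
proof (rule shifted_upsetI)
  show "E \<subseteq> {1..m}" if "E \<in> \<G> - critical_at m i \<G>" for E
    using that shifted_upset_subset[OF \<G>] by auto
next
  fix E F
  assume *: "E \<in> \<G> - critical_at m i \<G>" "E \<subseteq> F" "F \<subseteq> {1..m}"
  have "F \<in> \<G>"
    using * shifted_upset_superset[OF \<G>] by auto
  moreover have "F \<notin> critical_at m i \<G>"
  proof
    assume F: "F \<in> critical_at m i \<G>"
    then have "E \<noteq> F"
      using * by auto
    show False
    proof (cases "m \<in> E")
      case True
      then show False
        using critical_superset[OF \<G>, of E F] * F \<open>E \<noteq> F\<close> by (auto simp: critical_at_def critical_def)
    next
      case False
      then have "F - {m} \<in> \<G>"
        using shifted_upset_superset[OF \<G>, of E "F - {m}"] * by auto
      then show False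
        using F by (auto simp: critical_at_def critical_def)
    qed
  qed
  ultimately show "F \<in> \<G> - critical_at m i \<G>"
    by simp
next
  fix E l j
  assume *: "E \<in> \<G> - critical_at m i \<G>" "j \<in> E" "l \<notin> E" "1 \<le> l" "l < j"
  let ?E = "insert l (E - {j})"
  have "?E \<in> \<G>"
    using * shifted_upset_shift[OF \<G>] by auto
  moreover have "?E \<notin> critical_at m i \<G>"
  proof
    assume F: "?E \<in> critical_at m i \<G>"
    have E: "E \<subseteq> {1..m}" "E \<in> \<G>"
      using * shifted_upset_subset[OF \<G>] by auto
    then have "finite E"
      using finite_subset by blast
    have "m \<noteq> l"
      using * E by auto
    then have m: "m \<in> E" "m \<noteq> j"
      using F by (auto simp: critical_at_def critical_def)
    have "card ?E = card E"
      using * \<open>finite E\<close> by (intro card_shift) auto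
    then have "E - {m} \<in> \<G>"
      using * E F m by (auto simp: critical_at_def critical_def)
    then have "insert l (E - {m} - {j}) \<in> \<G>"
      using * m by (intro shifted_upset_shift[OF \<G>]) auto
    moreover have "insert l (E - {m} - {j}) = ?E - {m}"
      using * E by auto
    ultimately show False
      using F by (auto simp: critical_at_def critical_def)
  qed
  ultimately show "?E \<in> \<G> - critical_at m i \<G>"
    by simp
qed

text \<open>A proper superset of \<open>G - {m}\<close>, with \<open>G\<close> critical, either
  contains \<open>G\<close> or, with \<open>m\<close> inserted, properly contains \<open>G\<close>,
  so \<open>critical_superset\<close> applies. A shift of \<open>G - {m}\<close> is a shift of
  \<open>G\<close> without \<open>m\<close>; that shift of \<open>G\<close> is either critical of
  size \<open>i\<close> again or has its reduced set in \<open>\<G>\<close>.\<close>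

lemma shifted_upset_lower:
  assumes \<G>: "shifted_upset m \<G>"
  shows "shifted_upset m (lower m i \<G>)"
proof (rule shifted_upsetI)
  show "E \<subseteq> {1..m}" if "E \<in> lower m i \<G>" for E
    using that shifted_upset_subset[OF \<G>] by (fastforce simp: lower_def critical_at_def critical_def)
next
  fix E F
  assume *: "E \<in> lower m i \<G>" "E \<subseteq> F" "F \<subseteq> {1..m}"
  show "F \<in> lower m i \<G>"
  proof (cases "E \<in> \<G>")
    case True
    then show ?thesis
      using * shifted_upset_superset[OF \<G>] by (auto simp: lower_def)
  next
    case False
    then obtain G where G: "G \<in> critical_at m i \<G>" "E = G - {m}"
      using * by (auto simp: lower_def)
    then have "G \<in> \<G>" "m \<in> G"
      by (auto simp: critical_at_def critical_def)
    show ?thesis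
    proof (cases "F = E \<or> m \<in> F")
      case True
      then show ?thesis
        using * G \<open>G \<in> \<G>\<close> shifted_upset_superset[OF \<G>, of G F] by (auto simp: lower_def)
    next
      case False
      then have "G \<subset> insert m F" "insert m F \<subseteq> {1..m}" "insert m F - {m} = F"
        using * G \<open>m \<in> G\<close> shifted_upset_subset[OF \<G> \<open>G \<in> \<G>\<close>] by auto
      then show ?thesis
        using critical_superset[OF \<G> \<open>G \<in> \<G>\<close> \<open>m \<in> G\<close>, of "insert m F"] by (simp add: lower_def)
    qed
  qed
next
  fix E l j
  assume *: "E \<in> lower m i \<G>" "j \<in> E" "l \<notin> E" "1 \<le> l" "l < j"
  show "insert l (E - {j}) \<in> lower m i \<G>"
  proof (cases "E \<in> \<G>")
    case True
    then show ?thesis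
      using * shifted_upset_shift[OF \<G>] by (auto simp: lower_def)
  next
    case False
    then obtain G where G: "G \<in> critical_at m i \<G>" "E = G - {m}"
      using * by (auto simp: lower_def)
    then have "G \<in> \<G>" "m \<in> G" "card G = i"
      by (auto simp: critical_at_def critical_def)
    have sub: "G \<subseteq> {1..m}"
      using shifted_upset_subset[OF \<G> \<open>G \<in> \<G>\<close>] .
    then have "l \<noteq> m" "j \<noteq> m" "finite G"
      using * G finite_subset by auto
    let ?G = "insert l (G - {j})"
    have mem: "?G \<in> \<G>" "m \<in> ?G"
      using * G \<open>G \<in> \<G>\<close> \<open>m \<in> G\<close> \<open>l \<noteq> m\<close> \<open>j \<noteq> m\<close>
      by (auto intro!: shifted_upset_shift[OF \<G>])
    have "l \<notin> G" "j \<in> G"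
      using * G \<open>l \<noteq> m\<close> by auto
    then have "card ?G = i"
      using \<open>finite G\<close> \<open>card G = i\<close> card_shift[of G j l] by simp
    moreover have eq: "insert l (E - {j}) = ?G - {m}"
      using G \<open>l \<noteq> m\<close> by auto
    ultimately show ?thesis
      using mem by (cases "?G - {m} \<in> \<G>") (auto simp: lower_def critical_at_def critical_def)
  qed
qed

lemma critical_remove:
  "critical m (\<G> - critical_at m i \<G>) = critical m \<G> - critical_at m i \<G>"
  by (auto simp: critical_def critical_at_def)

text \<open>Adding \<open>E - {m}\<close> ends the criticality of \<open>E\<close> and of no other
  set containing \<open>m\<close>. Hence lowering and deleting shrink the critical sets alike, so
  both kinds of exchange decrease the number of critical sets.\<close>

lemma critical_lower: "critical m (lower m i \<G>) = critical m \<G> - critical_at m i \<G>"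
proof -
  have "E - {m} \<in> (\<lambda>E. E - {m}) ` critical_at m i \<G> \<longleftrightarrow> E \<in> critical_at m i \<G>" if "m \<in> E" for E
  proof
    assume "E - {m} \<in> (\<lambda>E. E - {m}) ` critical_at m i \<G>"
    then obtain F where F: "F \<in> critical_at m i \<G>" "E - {m} = F - {m}"
      by blast
    then have "m \<in> F"
      by (simp add: critical_at_def critical_def)
    then have "E = F"
      using F(2) that by blast
    then show "E \<in> critical_at m i \<G>"
      using F(1) by simp
  qed simp
  moreover have "E \<in> lower m i \<G> \<longleftrightarrow> E \<in> \<G>" if "m \<in> E" for E
    using that by (auto simp: lower_def)
  ultimately show ?thesis
    by (auto simp: critical_def lower_def)
qed

section \<open>Exchanges preserve cross intersection\<close>

lemma cross_intersecting_commute: "cross_intersecting t \<A> \<B> \<longleftrightarrow> cross_intersecting t \<B> \<A>"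
  unfolding cross_intersecting_def by (metis Int_commute)

lemma cross_intersecting_exchange:
  assumes \<G>: "shifted_upset m \<G>" and \<H>: "shifted_upset m \<H>"
    and cross: "cross_intersecting t \<G> \<H>" and ij: "i + j = m + t"
  shows "cross_intersecting t (\<G> - critical_at m i \<G>) (lower m j \<H>)"
  unfolding cross_intersecting_def
proof (intro ballI)
  fix E G
  assume E: "E \<in> \<G> - critical_at m i \<G>" and G: "G \<in> lower m j \<H>"
  show "t \<le> card (E \<inter> G)"
  proof (cases "G \<in> \<H>")
    case True
    then show ?thesis
      using E cross by (auto simp: cross_intersecting_def)
  next
    case False
    then obtain F where F: "F \<in> critical_at m j \<H>" "G = F - {m}"
      using G by (auto simp: lower_def)
    then have F': "F \<in> \<H>" "card F = j" "m \<in> F"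
      by (auto simp: critical_at_def critical_def)
    have sub: "E \<subseteq> {1..m}" "F \<subseteq> {1..m}"
      using E F' shifted_upset_subset \<G> \<H> by auto
    then have fin: "finite E" "finite F"
      using finite_subset by auto
    have le: "t \<le> card (E' \<inter> F)" if "E' \<in> \<G>" for E'
      using that F' cross by (auto simp: cross_intersecting_def)
    show ?thesis
    \<comment> \<open>If \<open>E\<close> is not critical, then \<open>E - {m}\<close> lies in
      \<open>\<G>\<close>, and its common elements with \<open>F\<close> all survive in
      \<open>G\<close>, which is \<open>F - {m}\<close>.\<close>
    proof (cases "m \<in> E \<and> E - {m} \<notin> \<G>")
      case False
      then have "t \<le> card ((E - {m}) \<inter> F)"
        using E le by (cases "m \<in> E") auto
      moreover have "(E - {m}) \<inter> F = E \<inter> G"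
        using F by auto
      ultimately show ?thesis
        by simp
    next
      case True
      then have "card E \<noteq> i" "E \<in> \<G>"
        using E by (auto simp: critical_at_def critical_def)
      have "card (E \<inter> F) \<noteq> t"
      proof
        assume t: "card (E \<inter> F) = t"
        show False
        proof (cases "E \<union> F = {1..m}")
          case True
          then have "card E + card F = m + t"
            using card_Un_Int[OF fin] t by simp
          then show False
            using \<open>card E \<noteq> i\<close> F' ij by simp
        next
          case False
          \<comment> \<open>Moving \<open>m\<close> in \<open>E\<close> to an uncovered
            \<open>l\<close> loses the common element \<open>m\<close> and gains none, so the
            intersection with \<open>F\<close> would drop below \<open>t\<close>.\<close>
          then obtain l where l: "l \<in> {1..m}" "l \<notin> E" "l \<notin> F"
            using sub by blast
          then have "insert l (E - {m}) \<in> \<G>"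
            using True \<open>E \<in> \<G>\<close> by (intro shifted_upset_shift[OF \<G>]) (auto simp: order.order_iff_strict)
          then have "t \<le> card (insert l (E - {m}) \<inter> F)"
            by (rule le)
          also have "insert l (E - {m}) \<inter> F = E \<inter> F - {m}"
            using l by auto
          also have "card \<dots> < card (E \<inter> F)"
            using True F' fin by (intro psubset_card_mono) auto
          finally show False
            using t by simp
        qed
      qed
      then have "t + 1 \<le> card (E \<inter> F)"
        using le[OF \<open>E \<in> \<G>\<close>] by simp
      moreover have "E \<inter> G = E \<inter> F - {m}"
        using F by auto
      moreover have "m \<in> E \<inter> F"
        using True F' by auto
      ultimately show ?thesis
        using fin by simp
    qed
  qed
qed

subsection \<open>Sizes of layers\<close>

definition layer :: "nat \<Rightarrow> nat \<Rightarrow> nat \<Rightarrow> nat set set \<Rightarrow> nat set set" where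
  "layer n k m \<G> = {A \<in> nsets {1..n} k. A \<inter> {1..m} \<in> \<G>}"

lemma finite_layer [simp]: "finite (layer n k m \<G>)"
  unfolding layer_def by (rule finite_subset[of _ "nsets {1..n} k"]) (auto intro: finite_imp_finite_nsets)

lemma layer_Diff: "layer n k m (\<G> - \<H>) = layer n k m \<G> - layer n k m \<H>"
  by (auto simp: layer_def)

lemma layer_Un: "layer n k m (\<G> \<union> \<H>) = layer n k m \<G> \<union> layer n k m \<H>"
  by (auto simp: layer_def)

lemma layer_mono: "\<G> \<subseteq> \<H> \<Longrightarrow> layer n k m \<G> \<subseteq> layer n k m \<H>"
  by (auto simp: layer_def)

lemma F0_eq_layer: "F0 t n k = layer n k t {{1..t}}"
  by (auto simp: F0_def layer_def)

lemma card_layer_uniform: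
  assumes \<G>: "\<And>E. E \<in> \<G> \<Longrightarrow> E \<subseteq> {1..m} \<and> card E = i" and "i \<le> k" "m \<le> n"
  shows "card (layer n k m \<G>) = card \<G> * ((n - m) choose (k - i))"
proof -
  have "bij_betw (\<lambda>A. (A \<inter> {1..m}, A - {1..m})) (layer n k m \<G>) (\<G> \<times> nsets {m+1..n} (k - i))"
  proof (rule bij_betwI[where g = "\<lambda>(E, R). E \<union> R"])
    show "(\<lambda>A. (A \<inter> {1..m}, A - {1..m})) \<in> layer n k m \<G> \<rightarrow> \<G> \<times> nsets {m+1..n} (k - i)"
    proof
      fix A assume "A \<in> layer n k m \<G>"
      then have A: "A \<subseteq> {1..n}" "finite A" "card A = k" "A \<inter> {1..m} \<in> \<G>"
        by (auto simp: layer_def nsets_def)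
      then have "card (A - {1..m}) = k - i"
        using \<G> card_Diff_subset_Int[of A "{1..m}"] by auto
      moreover have "A - {1..m} \<subseteq> {m+1..n}"
        using A by force
      ultimately show "(A \<inter> {1..m}, A - {1..m}) \<in> \<G> \<times> nsets {m+1..n} (k - i)"
        using A by (simp add: nsets_def)
    qed
    show "(\<lambda>(E, R). E \<union> R) \<in> \<G> \<times> nsets {m+1..n} (k - i) \<rightarrow> layer n k m \<G>"
    proof clarify
      fix E R assume E: "E \<in> \<G>" and R: "R \<in> nsets {m+1..n} (k - i)"
      have E': "E \<subseteq> {1..m}" "card E = i" "finite E"
        using \<G>[OF E] finite_subset by auto
      have R': "R \<subseteq> {m+1..n}" "card R = k - i" "finite R"
        using R by (auto simp: nsets_def)
      have "E \<inter> R = {}"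
        using E' R' by force
      then have "card (E \<union> R) = k"
        using E' R' \<open>i \<le> k\<close> by (simp add: card_Un_disjoint)
      moreover have "(E \<union> R) \<inter> {1..m} = E"
        using E' R' by force
      moreover have "E \<union> R \<subseteq> {1..n}"
        using E' R' \<open>m \<le> n\<close> by force
      ultimately show "E \<union> R \<in> layer n k m \<G>"
        using E E' R' by (simp add: layer_def nsets_def)
    qed
    show "(case (A \<inter> {1..m}, A - {1..m}) of (E, R) \<Rightarrow> E \<union> R) = A" for A :: "nat set"
      by auto
    show "(\<lambda>A. (A \<inter> {1..m}, A - {1..m})) (case y of (E, R) \<Rightarrow> E \<union> R) = y"
      if "y \<in> \<G> \<times> nsets {m+1..n} (k - i)" for y
    proof -
      obtain E R where y: "y = (E, R)" "E \<subseteq> {1..m}" "R \<subseteq> {m+1..n}"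
        using \<open>y \<in> _\<close> \<G> by (auto simp: nsets_def)
      have "(E \<union> R) \<inter> {1..m} = E" "(E \<union> R) - {1..m} = R"
        using y(2,3) by force+
      then show ?thesis
        using y(1) by simp
    qed
  qed
  from bij_betw_same_card[OF this] show ?thesis
    by (simp add: card_cartesian_product card_nsets)
qed

lemma layer_uniform_empty:
  assumes "\<And>E. E \<in> \<G> \<Longrightarrow> card E = i" "k < i"
  shows "layer n k m \<G> = {}"
proof -
  have "card (A \<inter> {1..m}) \<le> k" if "A \<in> nsets {1..n} k" for A
    using that card_mono[of A "A \<inter> {1..m}"] by (auto simp: nsets_def)
  then show ?thesis
    using assms by (fastforce simp: layer_def)
qed

lemma card_F0: "t \<le> k \<Longrightarrow> k \<le> n \<Longrightarrow> card (F0 t n k) = (n - t) choose (k - t)"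
  unfolding F0_eq_layer by (subst card_layer_uniform[where i = t]) auto

text \<open>Double counting: a critical \<open>i\<close>-set \<open>E\<close> with a marked
  \<open>l\<close> outside it goes to \<open>insert l (E - {m})\<close> with \<open>l\<close> marked
  inside, a member of \<open>\<G>\<close> of size \<open>i\<close> without \<open>m\<close>. The map
  is injective, so \<open>card C * (m - i) \<le> card S * i\<close>; adding
  \<open>card C * i\<close> gives the claim.\<close>

lemma card_critical_shift:
  assumes \<G>: "shifted_upset m \<G>"
  shows "card (critical_at m i \<G>) * m \<le> i * card {E \<in> \<G>. card E = i}"
proof -
  define C where "C = critical_at m i \<G>"
  define S where "S = {E \<in> \<G>. card E = i \<and> m \<notin> E}"
  have C: "E \<in> \<G>" "m \<in> E" "card E = i" "E \<subseteq> {1..m}" "finite E" if "E \<in> C" for E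
    using that shifted_upset_subset[OF \<G>] finite_subset[of E "{1..m}"]
    by (auto simp: C_def critical_at_def critical_def)
  have S: "E \<in> \<G>" "m \<notin> E" "card E = i" "finite E" if "E \<in> S" for E
    using that shifted_upset_subset[OF \<G>] finite_subset[of E "{1..m}"]
    by (auto simp: S_def)
  have fin: "finite C" "finite S" "finite {E \<in> \<G>. card E = i}"
    using shifted_upset_finite[OF \<G>] finite_subset[of C \<G>] critical_at_subset
    by (auto simp: C_def S_def)
  have "card (SIGMA E:C. {1..m} - E) \<le> card (SIGMA E:S. E)"
  proof (rule card_inj_on_le)
    show "inj_on (\<lambda>(E, l). (insert l (E - {m}), l)) (SIGMA E:C. {1..m} - E)"
    proof (rule inj_onI)
      fix p q assume p: "p \<in> (SIGMA E:C. {1..m} - E)" and q: "q \<in> (SIGMA E:C. {1..m} - E)"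
        and pq: "(case p of (E, l) \<Rightarrow> (insert l (E - {m}), l)) = (case q of (E, l) \<Rightarrow> (insert l (E - {m}), l))"
      obtain E E' l where E: "p = (E, l)" "q = (E', l)"
        and eq: "insert l (E - {m}) = insert l (E' - {m})"
        using pq by (cases p, cases q) auto
      have E': "E \<in> C" "E' \<in> C" "l \<notin> E" "l \<notin> E'"
        using p q E by auto
      have "E = insert m (insert l (E - {m}) - {l})"
        using C(2)[OF E'(1)] E'(3) by auto
      also have "\<dots> = E'"
        unfolding eq using C(2)[OF E'(2)] E'(4) by auto
      finally show "p = q"
        using E by simp
    qed
    show "(\<lambda>(E, l). (insert l (E - {m}), l)) ` (SIGMA E:C. {1..m} - E) \<subseteq> (SIGMA E:S. E)"
    proof clarify
      fix E l assume E: "E \<in> C" and l: "l \<in> {1..m}" "l \<notin> E"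
      have "l < m"
        using l C[OF E] by (cases "l = m") auto
      moreover have "insert l (E - {m}) \<in> \<G>"
        using C[OF E] l \<open>l < m\<close> by (intro shifted_upset_shift[OF \<G>]) auto
      ultimately show "insert l (E - {m}) \<in> S \<and> l \<in> insert l (E - {m})"
        using C[OF E] l card_shift[of E m l] by (auto simp: S_def)
    qed
    show "finite (SIGMA E:S. E)"
      using fin S by auto
  qed
  moreover have "card (SIGMA E:C. {1..m} - E) = card C * (m - i)"
    using fin C by (simp add: card_SigmaI card_Diff_subset)
  moreover have "card (SIGMA E:S. E) = card S * i"
    using fin S by (simp add: card_SigmaI)
  moreover have "card C + card S = card (C \<union> S)"
    using fin C(2) S(2) by (intro card_Un_disjoint[symmetric]) auto
  moreover have "card (C \<union> S) \<le> card {E \<in> \<G>. card E = i}"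
    using fin C S by (intro card_mono) auto
  moreover have "i \<le> m" if "C \<noteq> {}"
  proof -
    obtain E where "E \<in> C"
      using \<open>C \<noteq> {}\<close> by auto
    then show ?thesis
      using C[of E] card_mono[of "{1..m}" E] by simp
  qed
  ultimately have *: "card C * (m - i) \<le> card S * i" "card C + card S \<le> card {E \<in> \<G>. card E = i}"
    "C \<noteq> {} \<Longrightarrow> i \<le> m"
    by auto
  show ?thesis
  proof (cases "C = {}")
    case True
    then show ?thesis
      by (simp add: C_def)
  next
    case False
    then have "card C * m = card C * i + card C * (m - i)"
      using *(3) by (simp flip: distrib_left)
    also have "\<dots> \<le> (card C + card S) * i"
      using *(1) by (simp add: distrib_right)
    also have "\<dots> \<le> card {E \<in> \<G>. card E = i} * i"
      using *(2) by simp
    finally show ?thesis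
      by (simp add: C_def mult.commute)
  qed
qed

lemma card_layer_critical:
  assumes \<G>: "shifted_upset m \<G>" and "i \<le> k" "m \<le> n"
  shows "card (layer n k m (critical_at m i \<G>)) = card (critical_at m i \<G>) * ((n - m) choose (k - i))"
  using assms(2,3) shifted_upset_subset[OF \<G>] critical_at_subset
  by (intro card_layer_uniform) (auto simp: critical_at_def critical_def)

lemma card_layer_critical_fraction:
  assumes \<G>: "shifted_upset m \<G>" and "i \<le> k" "m \<le> n"
  shows "card (layer n k m (critical_at m i \<G>)) * m \<le> i * card (layer n k m \<G>)"
proof -
  have "card (layer n k m (critical_at m i \<G>)) * m
      = card (critical_at m i \<G>) * m * ((n - m) choose (k - i))"
    using card_layer_critical[OF assms] by simp
  also have "\<dots> \<le> i * card {E \<in> \<G>. card E = i} * ((n - m) choose (k - i))"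
    using card_critical_shift[OF \<G>] by (rule mult_right_mono) simp
  also have "\<dots> = i * card (layer n k m {E \<in> \<G>. card E = i})"
    using assms(2,3) shifted_upset_subset[OF \<G>] by (subst card_layer_uniform[where i = i]) auto
  also have "\<dots> \<le> i * card (layer n k m \<G>)"
    by (intro mult_left_mono card_mono layer_mono) auto
  finally show ?thesis .
qed

lemma layer_lower_Diff:
  "layer n k m (lower m i \<G>) - layer n k m \<G> = layer n k m ((\<lambda>E. E - {m}) ` critical_at m i \<G>)"
proof -
  have "(\<lambda>E. E - {m}) ` critical_at m i \<G> \<inter> \<G> = {}"
    by (auto simp: critical_at_def critical_def)
  then have "lower m i \<G> - \<G> = (\<lambda>E. E - {m}) ` critical_at m i \<G>"
    unfolding lower_def by blast
  then show ?thesis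
    by (simp flip: layer_Diff)
qed

lemma card_layer_lower_Diff:
  assumes \<G>: "shifted_upset m \<G>" and "1 \<le> i" "i \<le> k" "m \<le> n"
  shows "card (layer n k m (lower m i \<G>) - layer n k m \<G>)
    = card (critical_at m i \<G>) * ((n - m) choose (k - i + 1))"
proof -
  have C: "E \<subseteq> {1..m} \<and> m \<in> E \<and> card E = i" if "E \<in> critical_at m i \<G>" for E
    using that shifted_upset_subset[OF \<G>] by (auto simp: critical_at_def critical_def)
  have "inj_on (\<lambda>E. E - {m}) (critical_at m i \<G>)"
  proof (rule inj_onI)
    fix E F assume "E \<in> critical_at m i \<G>" "F \<in> critical_at m i \<G>" and eq: "E - {m} = F - {m}"
    then have "m \<in> E" "m \<in> F"
      using C by auto
    then have "E = insert m (E - {m})" "F = insert m (F - {m})"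
      by auto
    then show "E = F"
      using eq by simp
  qed
  then have "card ((\<lambda>E. E - {m}) ` critical_at m i \<G>) = card (critical_at m i \<G>)"
    by (rule card_image)
  \<comment> \<open>A lowered set has \<open>i - 1\<close> elements, so one more element is chosen
    outside \<open>{1..m}\<close>.\<close>
  moreover have "k - (i - 1) = k - i + 1"
    using assms by simp
  moreover have "E \<subseteq> {1..m} \<and> card E = i - 1" if E: "E \<in> (\<lambda>E. E - {m}) ` critical_at m i \<G>" for E
  proof -
    obtain F where F: "F \<in> critical_at m i \<G>" "E = F - {m}"
      using E by auto
    moreover have "finite F"
      using C[OF F(1)] finite_subset by blast
    ultimately show ?thesis
      using C[OF F(1)] by auto
  qed
  ultimately show ?thesis
    unfolding layer_lower_Diff using card_layer_uniform[of "(\<lambda>E. E - {m}) ` critical_at m i \<G>" m "i - 1" k n] assms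
    by simp
qed

subsection \<open>The gain of an exchange\<close>

text \<open>For a fixed sum \<open>s = d + e\<close> the right side is least at
  \<open>d = e\<close>, where it equals \<open>s / (t + s / 2)\<close>; after clearing denominators
  the difference is a multiple of the square of \<open>d - e\<close>. The minimum increases with
  \<open>s\<close>, and \<open>s \<ge> 3\<close>.\<close>

lemma slack_sum_ge:
  fixes t d e :: real
  assumes "0 < t" "0 \<le> d" "0 \<le> e" "3 \<le> d + e"
  shows "3 / (t + 3/2) \<le> e / (t + d) + d / (t + e)"
proof -
  define s where "s = d + e"
  have "3 / (t + 3/2) \<le> s / (t + s / 2)"
    using assms mult_right_mono[of 3 "d + e" t] by (simp add: s_def divide_simps algebra_simps)
  also have "\<dots> \<le> e / (t + d) + d / (t + e)"
  proof -
    have pos: "0 < t + d" "0 < t + e" "0 < t + s / 2"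
      using assms by (auto simp: s_def add_pos_nonneg)
    have "(e * (t + e) + d * (t + d)) * (t + s / 2) - s * ((t + d) * (t + e))
        = (t + s) * (d - e)\<^sup>2 / 2"
      by (simp add: s_def field_simps power2_eq_square)
    also have "0 \<le> \<dots>"
      using assms by (simp add: s_def)
    finally have "s * ((t + d) * (t + e)) \<le> (e * (t + e) + d * (t + d)) * (t + s / 2)"
      by simp
    then have "s / (t + s / 2) \<le> (e * (t + e) + d * (t + d)) / ((t + d) * (t + e))"
      using pos by (simp add: pos_divide_le_eq pos_le_divide_eq mult.commute)
    also have "\<dots> = e / (t + d) + d / (t + e)"
      using pos by (simp add: add_frac_eq)
    finally show ?thesis .
  qed
  finally show ?thesis .
qed

text \<open>Here \<open>e / (t + d)\<close> and \<open>d / (t + e)\<close> are the excess over 1 of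
  the least possible \<open>1 / X\<close> and \<open>1 / Y\<close> in an exchange. For
  \<open>d = e = 1\<close> and \<open>r = r' = t - 1\<close> the right side would be at most
  \<open>(t - 2) * 2 / (t + 1)\<close>, which is below 2; hence the assumption
  \<open>3 \<le> d + e\<close>.\<close>

lemma slack_bound:
  fixes t d e r r' :: real
  assumes t: "14 \<le> t" and de: "1 \<le> e" "e \<le> d" "3 \<le> d + e"
    and r: "t - 1 \<le> r" "r \<le> r'"
    and c: "c = 1 / (100 * t)"
  shows "2 + c * (r + r') \<le> ((1 - c) * r - 1) * (e / (t + d)) + ((1 - c) * r' - 1) * (d / (t + e))"
proof -
  define u where "u = e / (t + d)"
  define v where "v = d / (t + e)"
  define R where "R = r * u + r' * v"
  have uv: "0 \<le> u" "0 \<le> v"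
    using assms by (auto simp: u_def v_def)
  have s3: "3 / (t + 3/2) \<le> u + v"
    using slack_sum_ge[of t d e] assms by (simp add: u_def v_def)
  have "t * 1 \<le> t * d"
    using de t by (intro mult_left_mono) auto
  then have "t + e \<le> (t + 1) * d"
    using de by (simp add: distrib_right)
  then have "1 \<le> (t + 1) * v"
    using assms by (simp add: v_def divide_simps)
  then have "r' * 1 \<le> r' * ((t + 1) * v)"
    using assms by (intro mult_left_mono) auto
  moreover have "0 \<le> r * u"
    using uv r t by simp
  then have "0 \<le> (t + 1) * (r * u)"
    using t by simp
  ultimately have "r' \<le> (t + 1) * R"
    by (simp add: R_def algebra_simps)
  then have rr: "r + r' \<le> 2 * (t + 1) * R"
    using r mult.assoc[of 2 "t + 1" R] by linarith
  have "(t - 1) * u \<le> r * u" "(t - 1) * v \<le> r' * v"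
    using uv r by (auto intro!: mult_right_mono)
  then have Ruv: "(t - 1) * (u + v) \<le> R"
    by (simp add: R_def algebra_simps)
  have c0: "0 < c"
    using c t by simp
  have ct: "c * t = 1 / 100"
    using c t by simp
  have c1: "c \<le> 1 / 1400"
    unfolding c using t by (intro divide_left_mono) auto
  \<comment> \<open>The share of \<open>R\<close> that remains after subtracting
    \<open>c * R\<close> and \<open>c * (r + r')\<close>, the latter being at most
    \<open>2 * c * (t + 1) * R\<close>.\<close>
  define q where "q = 1 - c * (2 * t + 3)"
  have q: "q = 1 - 2 / 100 - 3 * c"
    using ct by (simp add: q_def algebra_simps)
  have "0 \<le> R"
    using Ruv uv t by (smt (verit) mult_nonneg_nonneg)
  have "c * (r + r') \<le> c * (2 * (t + 1) * R)"
    using rr c0 by simp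
  then have 1: "R * (1 - c) - c * (r + r') \<ge> q * R"
    by (simp add: q_def algebra_simps)
  have "q * ((t - 1) * (u + v)) \<le> q * R"
    using Ruv q c1 by (intro mult_left_mono) auto
  moreover have "(q * (t - 1) - 1) * (3 / (t + 3 / 2)) \<le> (q * (t - 1) - 1) * (u + v)"
  proof (rule mult_left_mono[OF s3])
    have "(1/2) * 13 \<le> q * (t - 1)"
      using q c1 t by (intro mult_mono) auto
    then show "0 \<le> q * (t - 1) - 1"
      by simp
  qed
  \<comment> \<open>This amounts to \<open>2 * t + 3 \<le> 3 * (q * (t - 1) - 1)\<close>. As
    \<open>q\<close> is close to 1, the right side grows almost like \<open>3 * t\<close>, and
    \<open>t \<ge> 14\<close> is large enough.\<close>
  moreover have "2 \<le> (q * (t - 1) - 1) * (3 / (t + 3 / 2))"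
  proof -
    have "(9/10) * (t - 1) \<le> q * (t - 1)"
      using q c1 t by (intro mult_right_mono) auto
    moreover have "q * (t - 1) = (98/100) * (t - 1) - 3 * (c * t) + 3 * c"
      by (simp add: q algebra_simps)
    ultimately have "2 * (t + 3 / 2) \<le> (q * (t - 1) - 1) * 3"
      using t ct c0 by argo
    then show ?thesis
      using t by (simp add: divide_simps)
  qed
  ultimately have "2 \<le> q * R - (u + v)"
    by (simp add: algebra_simps)
  then have "2 \<le> R * (1 - c) - c * (r + r') - (u + v)"
    using 1 by linarith
  then show ?thesis
    unfolding u_def[symmetric] v_def[symmetric] by (simp add: R_def algebra_simps)
qed

text \<open>The two right-hand factors add up to
  \<open>2 + (r - 1) * Y + (r' - 1) * X - (r + r') * X * Y\<close>. Divided by \<open>X * Y\<close>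
  the comparison becomes linear in \<open>1 / X\<close> and \<open>1 / Y\<close>, where the upper
  bounds on \<open>X\<close> and \<open>Y\<close> enter and \<open>slack_bound\<close> decides.
  Since the sum exceeds 2 by at least \<open>c * (r * Y + r' * X)\<close>, one factor exceeds 1 by
  at least half of this.\<close>

lemma exchange_gain:
  fixes t d e r r' X Y :: real
  assumes t: "14 \<le> t" and de: "1 \<le> d" "1 \<le> e" "3 \<le> d + e"
    and r: "t - 1 \<le> r" "t - 1 \<le> r'" "e \<le> d \<Longrightarrow> r \<le> r'" "d \<le> e \<Longrightarrow> r' \<le> r"
    and X: "0 < X" "X * (t + d + e) \<le> t + d" and Y: "0 < Y" "Y * (t + d + e) \<le> t + e"
    and c: "c = 1 / (100 * t)"
  shows "1 + c / 2 * (X + r * Y) \<le> (1 - X) * (1 + r * Y) \<or>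
         1 + c / 2 * (Y + r' * X) \<le> (1 - Y) * (1 + r' * X)"
proof -
  have "2 + c * (r + r') \<le> ((1 - c) * r - 1) * (e / (t + d)) + ((1 - c) * r' - 1) * (d / (t + e))"
  proof (cases "e \<le> d")
    case True
    then show ?thesis
      using slack_bound[of t e d r r' c] assms by simp
  next
    case False
    then show ?thesis
      using slack_bound[of t d e r' r c] assms by (simp add: add.commute)
  qed
  then have "r + r' \<le> ((1 - c) * r - 1) * (1 + e / (t + d)) + ((1 - c) * r' - 1) * (1 + d / (t + e))"
    by (simp add: algebra_simps)
  also have "\<dots> \<le> ((1 - c) * r - 1) * (1 / X) + ((1 - c) * r' - 1) * (1 / Y)"
  proof (intro add_mono mult_left_mono)
    have "c \<le> 1 / 1400"
      unfolding c using t by (intro divide_left_mono) auto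
    then have "(1 / 2) * 2 \<le> (1 - c) * r" "(1 / 2) * 2 \<le> (1 - c) * r'"
      using t r by (intro mult_mono; simp)+
    then show "0 \<le> (1 - c) * r - 1" "0 \<le> (1 - c) * r' - 1"
      by auto
    show "1 + e / (t + d) \<le> 1 / X" "1 + d / (t + e) \<le> 1 / Y"
      using assms by (simp_all add: divide_simps mult.commute add.commute add.left_commute)
  qed
  finally have "(r + r') * (X * Y) \<le> (((1 - c) * r - 1) * (1 / X) + ((1 - c) * r' - 1) * (1 / Y)) * (X * Y)"
    using X Y by (intro mult_right_mono) auto
  also have "\<dots> = ((1 - c) * r - 1) * Y + ((1 - c) * r' - 1) * X"
    using X Y by (simp add: field_simps)
  finally have *: "c * (r * Y + r' * X) + 2 \<le> (1 - X) * (1 + r * Y) + (1 - Y) * (1 + r' * X)"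
    by (simp add: algebra_simps)
  have c0: "0 < c"
    using c t by simp
  have "1 * X \<le> r' * X" "1 * Y \<le> r * Y"
    using r t X Y by (intro mult_right_mono; simp)+
  then have "c / 2 * (X + r * Y) \<le> c / 2 * (r * Y + r' * X)" "c / 2 * (Y + r' * X) \<le> c / 2 * (r * Y + r' * X)"
    using c0 by auto
  with * show ?thesis
    by argo
qed

lemma Suc_times_choose_Suc: "(r + 1) * (N choose (r + 1)) = (N - r) * (N choose r)"
  using binomial_absorption[of r N] binomial_absorb_comp[of N r] by simp

subsection \<open>The case m = t + 2\<close>

text \<open>By \<open>stable_exchange\<close>, a step of gain \<open>c\<close> tolerates \<open>\<kappa> \<le> (c / 4) / (1 + 2 * (c / 4))\<close>; the last three
  assumptions reflect the three kinds of steps, with \<open>c = 1 / (200 * t)\<close> in the generic one.\<close>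
locale ekr_parameters =
  fixes t k n :: nat and \<delta> \<kappa> :: real
  assumes t14: "14 \<le> t" and \<delta>: "0 < \<delta>" and tk: "t \<le> k"
    and n_ge: "(real t + 1 + \<delta>) * real k \<le> real n"
    and \<kappa>0: "0 \<le> \<kappa>" and \<kappa>6: "\<kappa> \<le> 1 / 6"
    and \<kappa>_generic: "\<kappa> \<le> (1 / (800 * real t)) / (1 + 2 * (1 / (800 * real t)))"
    and \<kappa>_extreme: "\<kappa> \<le> (\<delta> / (2 * (real t + 1) * (real t + \<delta>)) / 4)
                        / (1 + 2 * (\<delta> / (2 * (real t + 1) * (real t + \<delta>)) / 4))"
    and \<kappa>_middle: "\<kappa> \<le> \<delta> / (2 * (real t + 1 + \<delta>))"
begin

abbreviation "\<F> \<equiv> F0 t n k"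
abbreviation "M \<equiv> real ((n - t) choose (k - t))"

lemma n_ge_nat: "(t + 1) * k \<le> n"
proof -
  have "real ((t + 1) * k) \<le> (real t + 1 + \<delta>) * real k"
    using \<delta> by (simp add: algebra_simps)
  then show ?thesis
    using n_ge by linarith
qed

lemma n_ge_15: "15 * k \<le> n"
  using n_ge_nat mult_le_mono1[of 15 "t + 1" k] t14 by linarith

lemma card_\<F>: "real (card \<F>) = M"
  using card_F0[of t k n] tk n_ge_15 by simp

lemma finite_\<F>: "finite \<F>"
  by (simp add: F0_eq_layer)

lemma M_pos: "0 < M"
  using tk n_ge_15 by (simp add: zero_less_binomial)

lemma \<F>_nonempty: "\<F> \<noteq> {}"
  using M_pos card_\<F> by force

text \<open>The density condition passes to \<open>n - t\<close> and \<open>k - t\<close> with 1 to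
  spare, because \<open>(t + 1 + \<delta>) * t \<ge> 15 * t \<ge> t + 1\<close>.\<close>

lemma n_sub_t: "(real t + 1 + \<delta>) * real (k - t) \<le> real (n - t) - 1"
proof -
  define T where "T = real t + 1 + \<delta>"
  have "14 \<le> real t" "15 \<le> T"
    using t14 \<delta> by (auto simp: T_def)
  then have "15 * real t \<le> T * real t"
    by (intro mult_right_mono) auto
  then have "T * real k - T * real t \<le> real n - real t - 1"
    using n_ge \<open>14 \<le> real t\<close> unfolding T_def[symmetric] by linarith
  then show ?thesis
    using tk n_ge_15 by (simp add: of_nat_diff right_diff_distrib flip: T_def)
qed

text \<open>With \<open>N = n - t\<close> and \<open>K = k - t\<close>, traces of size
  \<open>t + 1\<close> and \<open>t + 2\<close> contribute, relative to \<open>M\<close>,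
  \<open>((t + 2) * K * (N - K) + K * (K - 1)) / (N * (N - 1))\<close>. This is
  \<open>1 - (N - K) * (N - 1 - (t + 1) * K) / (N * (N - 1))\<close>, so the gap below 1 comes from
  the excess of \<open>n\<close> over \<open>(t + 1) * k\<close>.\<close>

lemma card_layer_middle:
  assumes "t < k"
  shows "real (card (layer n k (t + 2) {G. G \<subseteq> {1..t + 2} \<and> t + 1 \<le> card G}))
    \<le> (1 - \<delta> / (2 * (real t + 1 + \<delta>))) * M" (is "real (card ?L) \<le> _")
proof -
  define N where "N = n - t"
  define K where "K = k - t"
  define T where "T = real t + 1 + \<delta>"
  have K1: "1 \<le> K"
    using assms by (simp add: K_def)
  have TK: "T * real K \<le> real N - 1"
    using n_sub_t by (simp add: T_def K_def N_def)
  have T15: "15 \<le> T"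
    using t14 \<delta> by (simp add: T_def)
  then have "15 * real K \<le> T * real K"
    by (intro mult_right_mono) auto
  then have NK: "15 * real K + 1 \<le> real N"
    using TK by linarith
  then have N2: "2 \<le> N" "K \<le> N"
    using K1 by linarith+
  then have N1: "1 \<le> N"
    by simp
  let ?A = "{G. G \<subseteq> {1..t + 2} \<and> card G = t + 1}"
  have "{G. G \<subseteq> {1..t + 2} \<and> t + 1 \<le> card G} \<subseteq> ?A \<union> {{1..t + 2}}"
  proof
    fix G assume G: "G \<in> {G. G \<subseteq> {1..t + 2} \<and> t + 1 \<le> card G}"
    show "G \<in> ?A \<union> {{1..t + 2}}"
    proof (cases "card G = t + 1")
      case False
      then have "card {1..t + 2} \<le> card G"
        using G by simp
      then have "G = {1..t + 2}"
        using G by (intro card_seteq) auto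
      then show ?thesis by simp
    qed (use G in simp)
  qed
  then have "card ?L \<le> card (layer n k (t + 2) ?A \<union> layer n k (t + 2) {{1..t + 2}})"
    unfolding layer_Un[symmetric] by (intro card_mono layer_mono) auto
  also have "\<dots> \<le> card (layer n k (t + 2) ?A) + card (layer n k (t + 2) {{1..t + 2}})"
    by (rule card_Un_le)
  finally have L: "card ?L \<le> \<dots>" .
  have A: "card (layer n k (t + 2) ?A) = (t + 2) * ((N - 2) choose (K - 1))"
  proof -
    have "card ?A = t + 2"
      using n_subsets[of "{1..t + 2}" "t + 1"] binomial_symmetric[of "t + 1" "t + 2"] by simp
    moreover have "t + 2 \<le> n" "t + 1 \<le> k"
      using assms n_ge_15 by linarith+
    ultimately show ?thesis
      using card_layer_uniform[of ?A "t + 2" "t + 1" k n] by (simp add: N_def K_def diff_diff_left)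
  qed
  have e1: "N * (N - 1) * ((N - 2) choose (K - 1)) = K * (N - K) * (N choose K)"
  proof -
    have "K * (N choose K) = N * ((N - 1) choose (K - 1))"
      using binomial_absorption[of "K - 1" N] K1 by simp
    moreover have "(N - K) * ((N - 1) choose (K - 1)) = (N - 1) * ((N - 2) choose (K - 1))"
      using binomial_absorb_comp[of "N - 1" "K - 1"] K1 N2 by (simp add: numeral_2_eq_2)
    ultimately show ?thesis
      by (metis mult.assoc mult.left_commute)
  qed
  have e2: "N * (N - 1) * card (layer n k (t + 2) {{1..t + 2}}) = K * (K - 1) * (N choose K)"
  \<comment> \<open>For \<open>K = 1\<close> no \<open>k\<close>-set contains
    \<open>{1..t + 2}\<close>, whereas the truncated \<open>K - 2\<close> would count one.\<close>
  proof (cases "K = 1")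
    case True
    then show ?thesis
      using layer_uniform_empty[of "{{1..t + 2}}" "t + 2" k n "t + 2"] by (simp add: K_def)
  next
    case False
    then have "t + 2 \<le> k" "t + 2 \<le> n"
      using K1 n_ge_15 by (auto simp: K_def)
    then have "card (layer n k (t + 2) {{1..t + 2}}) = (N - 2) choose (K - 2)"
      using card_layer_uniform[of "{{1..t + 2}}" "t + 2" "t + 2" k n] by (simp add: N_def K_def)
    moreover have "K * (N choose K) = N * ((N - 1) choose (K - 1))"
      using binomial_absorption[of "K - 1" N] K1 by simp
    moreover have "(K - 1) * ((N - 1) choose (K - 1)) = (N - 1) * ((N - 2) choose (K - 2))"
      using binomial_absorption[of "K - 2" "N - 1"] K1 False by (simp add: Suc_diff_Suc numeral_2_eq_2)
    ultimately show ?thesis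
      by (metis mult.assoc mult.left_commute)
  qed
  have "N * (N - 1) * card ?L
      \<le> N * (N - 1) * (card (layer n k (t + 2) ?A) + card (layer n k (t + 2) {{1..t + 2}}))"
    using L by (rule mult_left_mono) simp
  also have "\<dots> = (t + 2) * (N * (N - 1) * ((N - 2) choose (K - 1)))
      + N * (N - 1) * card (layer n k (t + 2) {{1..t + 2}})"
    unfolding A distrib_left by (simp only: mult_ac)
  also have "\<dots> = ((t + 2) * (K * (N - K)) + K * (K - 1)) * (N choose K)"
    unfolding e1 e2 distrib_right by (simp only: mult_ac)
  finally have "real (N * (N - 1) * card ?L) \<le> real (((t + 2) * (K * (N - K)) + K * (K - 1)) * (N choose K))"
    by (rule of_nat_mono)
  then have "real N * (real N - 1) * real (card ?L)
      \<le> ((real t + 2) * (real K * (real N - real K)) + real K * (real K - 1)) * real (N choose K)"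
    using N1 N2 K1 by (simp only: of_nat_mult of_nat_add of_nat_diff of_nat_1 of_nat_numeral)
  also have "(real t + 2) * (real K * (real N - real K)) + real K * (real K - 1)
      = real N * (real N - 1) - (real N - real K) * (real N - 1 - (real t + 1) * real K)"
    by (simp add: algebra_simps)
  also have "\<dots> * real (N choose K) \<le> (real N * (real N - 1) * (1 - \<delta> / (2 * T))) * real (N choose K)"
  proof (rule mult_right_mono)
    \<comment> \<open>Since \<open>T\<close> exceeds \<open>t + 1\<close> by
      \<open>\<delta>\<close>, the factor \<open>N - 1 - (t + 1) * K\<close> is at least the
      fraction \<open>\<delta> / T\<close> of \<open>N - 1\<close>; the factor \<open>N - K\<close>
      is at least \<open>N / 2\<close>.\<close>
    have "(real t + 1) * real K = T * real K * (1 - \<delta> / T)"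
      using T15 by (simp add: T_def field_simps)
    also have "\<dots> \<le> (real N - 1) * (1 - \<delta> / T)"
      using TK T15 by (intro mult_right_mono) (auto simp: T_def)
    finally have "(real N - 1) * (\<delta> / T) \<le> real N - 1 - (real t + 1) * real K"
      by (simp add: algebra_simps)
    then have "(real N / 2) * ((real N - 1) * (\<delta> / T))
        \<le> (real N - real K) * (real N - 1 - (real t + 1) * real K)"
      using NK N2 T15 \<delta> by (intro mult_mono) auto
    then show "real N * (real N - 1) - (real N - real K) * (real N - 1 - (real t + 1) * real K)
        \<le> real N * (real N - 1) * (1 - \<delta> / (2 * T))"
      by (simp add: algebra_simps)
  qed simp
  finally have "(real N * (real N - 1)) * real (card ?L)
      \<le> (real N * (real N - 1)) * ((1 - \<delta> / (2 * T)) * real (N choose K))"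
    by (simp add: mult_ac)
  moreover have "0 < real N * (real N - 1)"
    using N2 by simp
  ultimately have "real (card ?L) \<le> (1 - \<delta> / (2 * T)) * real (N choose K)"
    by (simp only: mult_le_cancel_left_pos)
  then show ?thesis
    by (simp only: T_def N_def K_def)
qed

text \<open>A member \<open>G\<close> with at most \<open>t\<close> elements is a
  \<open>t\<close>-set contained in every member of \<open>\<H>\<close>. The set \<open>F\<close>
  misses a single \<open>q\<close>, and \<open>F\<close> with \<open>t + 2\<close> moved to
  \<open>q\<close> is also in \<open>\<H>\<close>, so \<open>G\<close> is
  \<open>{1..t + 1} - {q}\<close>. If this is not \<open>{1..t}\<close>, shifting puts
  \<open>{1..t}\<close> into \<open>\<G>\<close>, which must then lie inside \<open>F\<close>
  although \<open>F\<close> misses \<open>q\<close>.\<close>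

lemma middle_card:
  assumes \<G>: "shifted_upset (t + 2) \<G>" and \<H>: "shifted_upset (t + 2) \<H>"
    and cross: "cross_intersecting t \<G> \<H>"
    and F: "F \<in> critical_at (t + 2) (t + 1) \<H>" and G: "G \<in> \<G>" "G \<noteq> {1..t}"
  shows "t + 1 \<le> card G"
proof (rule ccontr)
  assume "\<not> t + 1 \<le> card G"
  have F': "F \<in> \<H>" "t + 2 \<in> F" "card F = t + 1" "F \<subseteq> {1..t + 2}"
    using F shifted_upset_subset[OF \<H>] by (auto simp: critical_at_def critical_def)
  have finF: "finite F"
    using F'(4) finite_subset by blast
  have sub: "G \<subseteq> {1..t + 2}" "finite G"
    using G shifted_upset_subset[OF \<G>] finite_subset by blast+
  have inF: "G \<subseteq> H" if "H \<in> \<H>" for H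
  proof -
    have "t \<le> card (G \<inter> H)"
      using cross G that by (auto simp: cross_intersecting_def)
    then have "G \<inter> H = G"
      using sub \<open>\<not> t + 1 \<le> card G\<close> by (intro card_seteq) auto
    then show ?thesis by auto
  qed
  have cG: "card G = t"
    using cross G F'(1) inF[OF F'(1)] \<open>\<not> t + 1 \<le> card G\<close>
    by (fastforce simp: cross_intersecting_def Int_absorb2)
  have "F \<noteq> {1..t + 2}"
    using F'(3) by auto
  then obtain q where q: "q \<in> {1..t + 2}" "q \<notin> F"
    using F'(4) by blast
  then have qt: "q \<le> t + 1"
    using F'(2) by (cases "q = t + 2") auto
  have "insert q (F - {t + 2}) \<in> \<H>"
    using F' q qt by (intro shifted_upset_shift[OF \<H>]) auto
  then have "G \<subseteq> insert q (F - {t + 2})" "G \<subseteq> F"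
    using inF F' by auto
  then have "t + 2 \<notin> G" "q \<notin> G"
    using q qt by auto
  have Gq: "G \<subseteq> {1..t + 1} - {q}"
  proof
    fix x assume "x \<in> G"
    then have "1 \<le> x" "x \<le> t + 2" "x \<noteq> t + 2" "x \<noteq> q"
      using sub \<open>t + 2 \<notin> G\<close> \<open>q \<notin> G\<close> by auto
    then show "x \<in> {1..t + 1} - {q}"
      by simp
  qed
  have "card ({1..t + 1} - {q}) = t"
    using q qt by simp
  then have G_eq: "G = {1..t + 1} - {q}"
    using Gq cG by (intro card_seteq) auto
  show False
  proof (cases "q = t + 1")
    case True
    then have "G = {1..t}"
      using G_eq by auto
    then show False
      using G by simp
  next
    case False
    then have "insert q (G - {t + 1}) \<in> \<G>"
      using G_eq q qt G by (intro shifted_upset_shift[OF \<G>]) auto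
    moreover have "insert q (G - {t + 1}) = {1..t}"
      using G_eq q qt False by auto
    ultimately have "t \<le> card ({1..t} \<inter> F)"
      using cross F' by (auto simp: cross_intersecting_def)
    also have "\<dots> < card {1..t}"
    proof (rule psubset_card_mono)
      have "q \<in> {1..t}"
        using q qt False by simp
      then show "{1..t} \<inter> F \<subset> {1..t}"
        using q(2) by blast
    qed simp
    finally show False by simp
  qed
qed

text \<open>Every member of \<open>\<H>\<close> contains \<open>{1..t}\<close>. The critical
  \<open>F\<close> must be \<open>{1..t}\<close> with \<open>t + 2\<close> added, so
  \<open>{1..t}\<close> itself is not in \<open>\<H>\<close>. The second layer then has at most
  \<open>2 / 15\<close> of the size of the star, the first at most twice that size.\<close>

lemma middle_product_star:
  assumes \<G>: "shifted_upset (t + 2) \<G>" and \<H>: "shifted_upset (t + 2) \<H>"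
    and cross: "cross_intersecting t \<G> \<H>" and "t < k"
    and F: "F \<in> critical_at (t + 2) (t + 1) \<H>" and star: "{1..t} \<in> \<G>"
  shows "real (card (layer n k (t + 2) \<G>)) * real (card (layer n k (t + 2) \<H>)) \<le> (1 - \<kappa>) * M\<^sup>2"
proof -
  let ?L = "layer n k (t + 2) {G. G \<subseteq> {1..t + 2} \<and> t + 1 \<le> card G}"
  have "layer n k (t + 2) \<G> \<subseteq> layer n k (t + 2) ({{1..t}} \<union> {G. G \<subseteq> {1..t + 2} \<and> t + 1 \<le> card G})"
    using middle_card[OF \<G> \<H> cross F] shifted_upset_subset[OF \<G>] by (intro layer_mono) blast
  also have "\<dots> = layer n k (t + 2) {{1..t}} \<union> ?L"
    by (rule layer_Un)
  also have "layer n k (t + 2) {{1..t}} \<subseteq> \<F>"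
    by (auto simp: layer_def F0_def)
  finally have "card (layer n k (t + 2) \<G>) \<le> card (\<F> \<union> ?L)"
    using finite_\<F> by (intro card_mono) auto
  also have "\<dots> \<le> card \<F> + card ?L"
    by (rule card_Un_le)
  finally have "real (card (layer n k (t + 2) \<G>)) \<le> M + real (card ?L)"
    using card_\<F> by linarith
  moreover have "(1 - \<delta> / (2 * (real t + 1 + \<delta>))) * M \<le> 1 * M"
    using \<delta> by (intro mult_right_mono) auto
  ultimately have a: "real (card (layer n k (t + 2) \<G>)) \<le> 2 * M"
    using card_layer_middle[OF \<open>t < k\<close>] by linarith
  have F': "F \<in> \<H>" "t + 2 \<in> F" "card F = t + 1" "F - {t + 2} \<notin> \<H>"
    using F by (auto simp: critical_at_def critical_def)
  have star_le: "{1..t} \<subseteq> H" if "H \<in> \<H>" for H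
  proof -
    have "t \<le> card ({1..t} \<inter> H)"
      using cross star that by (auto simp: cross_intersecting_def)
    then have "{1..t} \<inter> H = {1..t}"
      by (intro card_seteq) auto
    then show ?thesis by auto
  qed
  have "finite F"
    using F'(3) card_ge_0_finite by force
  then have "card (F - {t + 2}) = card {1..t}"
    using F' by simp
  moreover have "{1..t} \<subseteq> F - {t + 2}"
    using star_le[OF F'(1)] by auto
  ultimately have "{1..t} = F - {t + 2}"
    using \<open>finite F\<close> by (intro card_subset_eq) auto
  then have "{1..t} \<notin> \<H>"
    using F' by simp
  \<comment> \<open>A trace properly containing \<open>{1..t}\<close> contains \<open>t + 1\<close>,
    or else it is \<open>{1..t}\<close> together with \<open>t + 2\<close>.\<close>
  have "layer n k (t + 2) \<H> \<subseteq> layer n k (t + 1) {{1..t + 1}} \<union> layer n k (t + 2) {insert (t + 2) {1..t}}"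
  proof
    fix B assume B: "B \<in> layer n k (t + 2) \<H>"
    then have "B \<inter> {1..t + 2} \<in> \<H>" "B \<in> nsets {1..n} k"
      by (auto simp: layer_def)
    moreover from this have tB: "{1..t} \<subseteq> B" "B \<inter> {1..t + 2} \<noteq> {1..t}"
      using star_le \<open>{1..t} \<notin> \<H>\<close> by auto
    moreover have "B \<inter> {1..t + 1} = {1..t + 1}" if "t + 1 \<in> B"
      using that tB(1) by (auto simp: le_Suc_eq)
    moreover have "B \<inter> {1..t + 2} = insert (t + 2) {1..t}" if "t + 1 \<notin> B"
    proof -
      have "t + 2 \<in> B"
      proof (rule ccontr)
        assume "t + 2 \<notin> B"
        then have "B \<inter> {1..t + 2} = {1..t}"
          using that tB(1) by (auto simp: le_Suc_eq)
        then show False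
          using tB(2) by simp
      qed
      then show ?thesis
        using that tB(1) by (auto simp: le_Suc_eq)
    qed
    ultimately show "B \<in> layer n k (t + 1) {{1..t + 1}} \<union> layer n k (t + 2) {insert (t + 2) {1..t}}"
      by (auto simp: layer_def)
  qed
  then have "card (layer n k (t + 2) \<H>)
      \<le> card (layer n k (t + 1) {{1..t + 1}} \<union> layer n k (t + 2) {insert (t + 2) {1..t}})"
    by (intro card_mono) auto
  also have "\<dots> \<le> card (layer n k (t + 1) {{1..t + 1}}) + card (layer n k (t + 2) {insert (t + 2) {1..t}})"
    by (rule card_Un_le)
  also have "card (layer n k (t + 1) {{1..t + 1}}) = (n - (t + 1)) choose (k - (t + 1))"
    using \<open>t < k\<close> n_ge_15 by (subst card_layer_uniform[where i = "t + 1"]) auto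
  also have "card (layer n k (t + 2) {insert (t + 2) {1..t}}) = (n - (t + 2)) choose (k - (t + 1))"
    using \<open>t < k\<close> n_ge_15 by (subst card_layer_uniform[where i = "t + 1"]) auto
  also have "(n - (t + 2)) choose (k - (t + 1)) \<le> (n - (t + 1)) choose (k - (t + 1))"
    by (rule binomial_right_mono) simp
  finally have b1: "card (layer n k (t + 2) \<H>) \<le> 2 * ((n - (t + 1)) choose (k - (t + 1)))"
    by simp
  have kt: "k - t = Suc (k - (t + 1))"
    using \<open>t < k\<close> by simp
  have "(k - t) * ((n - t) choose (k - t)) = (n - t) * ((n - (t + 1)) choose (k - (t + 1)))"
    by (simp only: kt binomial_absorption diff_diff_left)
  then have absorb: "real (k - t) * M = real (n - t) * real ((n - (t + 1)) choose (k - (t + 1)))"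
    by (metis of_nat_mult)
  have "15 * real (k - t) \<le> (real t + 1 + \<delta>) * real (k - t)"
    using t14 \<delta> by (intro mult_right_mono) auto
  then have "15 * real (k - t) \<le> real (n - t)"
    using n_sub_t by linarith
  then have "15 * real (k - t) * real ((n - (t + 1)) choose (k - (t + 1))) \<le> real (k - t) * M"
    unfolding absorb by (rule mult_right_mono) simp
  then have "real (k - t) * (15 * real ((n - (t + 1)) choose (k - (t + 1)))) \<le> real (k - t) * M"
    by (simp only: mult_ac)
  then have "15 * real ((n - (t + 1)) choose (k - (t + 1))) \<le> M"
    using \<open>t < k\<close> by (simp add: mult_le_cancel_left_pos)
  then have b: "real (card (layer n k (t + 2) \<H>)) \<le> M / 4"
    using b1 by linarith
  have "real (card (layer n k (t + 2) \<G>)) * real (card (layer n k (t + 2) \<H>)) \<le> (2 * M) * (M / 4)"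
    using a b M_pos by (intro mult_mono) auto
  also have "\<dots> = (1 / 2) * M\<^sup>2"
    by (simp add: power2_eq_square)
  also have "\<dots> \<le> (1 - \<kappa>) * M\<^sup>2"
    using \<kappa>6 by (intro mult_right_mono) auto
  finally show ?thesis .
qed

text \<open>If \<open>{1..t}\<close> is in neither up-set, \<open>middle_card\<close> applied both
  ways puts both layers into the family of \<open>card_layer_middle\<close>, and the square of its
  factor is at most the factor itself.\<close>

lemma middle_product:
  assumes \<G>: "shifted_upset (t + 2) \<G>" and \<H>: "shifted_upset (t + 2) \<H>"
    and cross: "cross_intersecting t \<G> \<H>" and "t < k"
    and E: "E \<in> critical_at (t + 2) (t + 1) \<G>" and F: "F \<in> critical_at (t + 2) (t + 1) \<H>"
  shows "real (card (layer n k (t + 2) \<G>)) * real (card (layer n k (t + 2) \<H>)) \<le> (1 - \<kappa>) * M\<^sup>2"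
proof -
  have cross': "cross_intersecting t \<H> \<G>"
    using cross by (simp add: cross_intersecting_commute)
  consider "{1..t} \<in> \<G>" | "{1..t} \<in> \<H>" | "{1..t} \<notin> \<G>" "{1..t} \<notin> \<H>"
    by blast
  then show ?thesis
  proof cases
    case 1
    then show ?thesis
      using middle_product_star[OF \<G> \<H> cross \<open>t < k\<close> F] by simp
  next
    case 2
    then show ?thesis
      using middle_product_star[OF \<H> \<G> cross' \<open>t < k\<close> E] by (simp add: mult.commute)
  next
    case 3
    let ?c = "1 - \<delta> / (2 * (real t + 1 + \<delta>))"
    let ?L = "layer n k (t + 2) {G. G \<subseteq> {1..t + 2} \<and> t + 1 \<le> card G}"
    have "card (layer n k (t + 2) \<G>) \<le> card ?L"
      using middle_card[OF \<G> \<H> cross F] shifted_upset_subset[OF \<G>] 3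
      by (intro card_mono layer_mono) auto
    then have a: "real (card (layer n k (t + 2) \<G>)) \<le> ?c * M"
      using card_layer_middle[OF \<open>t < k\<close>] by linarith
    have "card (layer n k (t + 2) \<H>) \<le> card ?L"
      using middle_card[OF \<H> \<G> cross' E] shifted_upset_subset[OF \<H>] 3
      by (intro card_mono layer_mono) auto
    then have b: "real (card (layer n k (t + 2) \<H>)) \<le> ?c * M"
      using card_layer_middle[OF \<open>t < k\<close>] by linarith
    have c: "0 \<le> ?c" "?c \<le> 1" "?c \<le> 1 - \<kappa>"
      using \<delta> \<kappa>_middle by (simp_all add: divide_le_eq)
    have "real (card (layer n k (t + 2) \<G>)) * real (card (layer n k (t + 2) \<H>)) \<le> (?c * M) * (?c * M)"
      using a b c M_pos by (intro mult_mono) auto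
    also have "\<dots> = (?c * ?c) * M\<^sup>2"
      by (simp add: power2_eq_square)
    also have "?c * ?c \<le> (1 - \<kappa>) * 1"
      using c by (intro mult_mono) auto
    finally show ?thesis
      by (simp add: mult_right_mono)
  qed
qed

end

subsection \<open>Exchange steps\<close>

context ekr_parameters
begin

text \<open>The factor by which a family of critical \<open>i\<close>-sets gains sets of the layer when \<open>m\<close> is removed.\<close>
definition growth :: "nat \<Rightarrow> nat \<Rightarrow> real" where
  "growth m i = real (n - m - (k - i)) / real (k - i + 1)"

definition fraction :: "nat \<Rightarrow> nat \<Rightarrow> nat set set \<Rightarrow> real" where
  "fraction m i \<G> = real (card (layer n k m (critical_at m i \<G>))) / real (card (layer n k m \<G>))"

lemma card_lower_gain:
  assumes \<G>: "shifted_upset m \<G>" and "1 \<le> i" "i \<le> k" "m \<le> n"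
  shows "real (card (layer n k m (lower m i \<G>) - layer n k m \<G>))
    = growth m i * real (card (layer n k m (critical_at m i \<G>)))"
proof -
  let ?c = "(n - m) choose (k - i)"
  have "(k - i + 1) * ((n - m) choose (k - i + 1)) = (n - m - (k - i)) * ?c"
    by (rule Suc_times_choose_Suc)
  then have "real (k - i + 1) * real ((n - m) choose (k - i + 1)) = real (n - m - (k - i)) * real ?c"
    by (metis of_nat_mult)
  then have "real ((n - m) choose (k - i + 1)) = growth m i * real ?c"
    by (simp add: growth_def field_simps)
  then show ?thesis
    using card_layer_lower_Diff[OF assms] card_layer_critical[OF \<G> assms(3,4)] by simp
qed

text \<open>Translation of \<open>stable_exchange\<close> into shares: with \<open>X\<close> and
  \<open>Y\<close> the fractions of the two layers that are critical and \<open>r\<close> the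
  growth, deletion leaves the factor \<open>1 - X\<close> and lowering yields
  \<open>1 + r * Y\<close>.\<close>

lemma stable_exchange_layers:
  assumes \<G>: "shifted_upset m \<G>" and \<H>: "shifted_upset m \<H>"
    and ij: "1 \<le> j" "j \<le> k" "m \<le> n"
    and ne: "layer n k m \<G> \<noteq> {}" "layer n k m \<H> \<noteq> {}"
    and gain: "1 + c * (fraction m i \<G> + growth m j * fraction m j \<H>)
      \<le> (1 - fraction m i \<G>) * (1 + growth m j * fraction m j \<H>)"
    and stab: "stable \<kappa> \<F> (layer n k m (\<G> - critical_at m i \<G>)) (layer n k m (lower m j \<H>))"
    and c: "0 \<le> c" "\<kappa> \<le> (c / 4) / (1 + 2 * (c / 4))"
  shows "stable \<kappa> \<F> (layer n k m \<G>) (layer n k m \<H>)"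
proof -
  let ?A = "layer n k m \<G>" and ?A' = "layer n k m (\<G> - critical_at m i \<G>)"
  let ?B = "layer n k m \<H>" and ?B' = "layer n k m (lower m j \<H>)"
  let ?C = "layer n k m (critical_at m i \<G>)"
  define a where "a = real (card ?A)"
  define b where "b = real (card ?B)"
  have pos: "0 < a" "0 < b"
    using ne by (auto simp: a_def b_def card_gt_0_iff)
  have subC: "?C \<subseteq> ?A"
    using critical_at_subset by (rule layer_mono)
  have subB: "?B \<subseteq> ?B'"
    by (rule layer_mono) (auto simp: lower_def)
  have diffA: "?A - ?A' = ?C"
    using subC by (auto simp: layer_Diff)
  have x: "real (card ?C) = fraction m i \<G> * a"
    using ne(1) by (simp add: fraction_def a_def)
  have cA': "real (card ?A') = (1 - fraction m i \<G>) * a"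
  proof -
    have "card ?A' = card ?A - card ?C" "card ?C \<le> card ?A"
      using subC by (simp_all add: layer_Diff card_Diff_subset card_mono)
    then show ?thesis
      using x by (simp add: a_def of_nat_diff left_diff_distrib)
  qed
  have y: "real (card (?B' - ?B)) = growth m j * fraction m j \<H> * b"
    using card_lower_gain[OF \<H> ij] ne(2) by (simp add: fraction_def b_def)
  have cB': "real (card ?B') = (1 + growth m j * fraction m j \<H>) * b"
  proof -
    have "card (?B' - ?B) = card ?B' - card ?B" "card ?B \<le> card ?B'"
      using subB by (simp_all add: card_Diff_subset card_mono)
    then have "real (card ?B') = b + real (card (?B' - ?B))"
      by (simp add: b_def of_nat_diff)
    then show ?thesis
      using y by (simp add: distrib_right)
  qed
  have "(1 + c * (real (card (?A - ?A')) / a + real (card (?B' - ?B)) / b)) * (a * b)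
      = (1 + c * (fraction m i \<G> + growth m j * fraction m j \<H>)) * (a * b)"
    using pos by (simp add: diffA x y)
  also have "\<dots> \<le> ((1 - fraction m i \<G>) * (1 + growth m j * fraction m j \<H>)) * (a * b)"
    using gain pos by (intro mult_right_mono) auto
  also have "\<dots> = real (card ?A') * real (card ?B')"
    unfolding cA' cB' by (simp only: mult_ac)
  finally have g: "(1 + c * (real (card (?A - ?A')) / real (card ?A) + real (card (?B' - ?B)) / real (card ?B)))
      * (real (card ?A) * real (card ?B)) \<le> real (card ?A') * real (card ?B')"
    by (simp only: a_def b_def)
  show ?thesis
    by (rule stable_exchange[OF _ _ finite_\<F> _ subB ne \<F>_nonempty g stab c(1) \<kappa>0 c(2)])
      (auto simp: layer_Diff)
qed

lemma fraction_le:
  assumes "shifted_upset m \<G>" "i \<le> k" "m \<le> n" "layer n k m \<G> \<noteq> {}"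
  shows "fraction m i \<G> * real m \<le> real i"
proof -
  have "real (card (layer n k m (critical_at m i \<G>)) * m) \<le> real (i * card (layer n k m \<G>))"
    using card_layer_critical_fraction[OF assms(1-3)] by (rule of_nat_mono)
  moreover have "0 < card (layer n k m \<G>)"
    using assms(4) by (simp add: card_gt_0_iff)
  ultimately show ?thesis
    by (simp add: fraction_def divide_simps)
qed

lemma growth_eq:
  assumes "i + j = m + t" "i \<le> k" "j \<le> k" "t \<le> i" "t \<le> j"
  shows "growth m i = (real n - real k - (real j - real t)) / (real k - real i + 1)"
proof -
  have "m + (k - i) = k + (j - t)" "k + (j - t) \<le> n"
    using assms n_ge_15 by linarith+
  then have "real (n - m - (k - i)) = real n - real k - (real j - real t)"
    using assms by (simp add: diff_diff_left of_nat_diff)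
  then show ?thesis
    using assms by (simp add: growth_def of_nat_diff)
qed

text \<open>In the form of \<open>growth_eq\<close>, the denominator is at most \<open>k\<close> and
  the numerator at least \<open>n - 2 * k\<close>, which is at least
  \<open>(t - 1) * k\<close>.\<close>

lemma growth_ge:
  assumes "i + j = m + t" "i \<le> k" "j \<le> k" "t < i" "t < j"
  shows "real t - 1 \<le> growth m i"
proof -
  have "(real t - 1) * (real k - real i + 1) \<le> (real t - 1) * real k"
    using assms t14 by (intro mult_left_mono) auto
  also have "\<dots> = real ((t + 1) * k) - 2 * real k"
    by (simp add: algebra_simps)
  also have "\<dots> \<le> real n - real k - (real j - real t)"
    using n_ge_nat of_nat_mono[OF n_ge_nat, where 'a = real] assms by linarith
  finally show ?thesis
    using assms growth_eq[of i j m] by (simp add: pos_le_divide_eq)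
qed

text \<open>For the larger size the denominator is smaller and the numerator larger. This supplies
  the ordering of \<open>r\<close> and \<open>r'\<close> that \<open>exchange_gain\<close>
  requires.\<close>

lemma growth_mono:
  assumes "i + j = m + t" "i \<le> k" "j \<le> k" "t \<le> i" "t \<le> j" "j \<le> i"
  shows "growth m j \<le> growth m i"
proof -
  have "growth m j = (real n - real k - (real i - real t)) / (real k - real j + 1)"
    using assms by (intro growth_eq) auto
  also have "\<dots> \<le> (real n - real k - (real j - real t)) / (real k - real i + 1)"
    using assms n_ge_15 by (intro frac_le) auto
  finally show ?thesis
    using growth_eq[of i j m] assms by simp
qed

lemma generic_step:
  assumes \<G>: "shifted_upset m \<G>" and \<H>: "shifted_upset m \<H>"
    and ij: "i + j = m + t" "i \<le> k" "j \<le> k" "t < i" "t < j" "t + 2 < m"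
    and ne: "layer n k m (critical_at m i \<G>) \<noteq> {}" "layer n k m (critical_at m j \<H>) \<noteq> {}"
    and stab1: "stable \<kappa> \<F> (layer n k m (\<G> - critical_at m i \<G>)) (layer n k m (lower m j \<H>))"
    and stab2: "stable \<kappa> \<F> (layer n k m (lower m i \<G>)) (layer n k m (\<H> - critical_at m j \<H>))"
  shows "stable \<kappa> \<F> (layer n k m \<G>) (layer n k m \<H>)"
proof -
  define c where "c = 1 / (100 * real t)"
  have c0: "0 \<le> c / 2"
    by (simp add: c_def)
  have \<kappa>c: "\<kappa> \<le> (c / 2 / 4) / (1 + 2 * (c / 2 / 4))"
    using \<kappa>_generic by (simp add: c_def)
  have mn: "m \<le> n"
    using ij n_ge_15 by linarith
  have ne': "layer n k m \<G> \<noteq> {}" "layer n k m \<H> \<noteq> {}"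
    using ne layer_mono[OF critical_at_subset] by blast+
  have pos: "0 < fraction m i \<G>" "0 < fraction m j \<H>"
    using ne ne' by (simp_all add: fraction_def card_gt_0_iff)
  have ji: "j + i = m + t"
    using ij by simp
  have m: "real t + (real i - real t) + (real j - real t) = real m"
    using of_nat_add[of i j, where 'a = real] ij(1) by simp
  have "1 + c / 2 * (fraction m i \<G> + growth m j * fraction m j \<H>)
        \<le> (1 - fraction m i \<G>) * (1 + growth m j * fraction m j \<H>) \<or>
      1 + c / 2 * (fraction m j \<H> + growth m i * fraction m i \<G>)
        \<le> (1 - fraction m j \<H>) * (1 + growth m i * fraction m i \<G>)"
  \<comment> \<open>The sizes are written as \<open>t + d\<close> and \<open>t + e\<close>; then
    \<open>d + e = m - t\<close>, which is at least 3 by \<open>t + 2 < m\<close>.\<close>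
  proof (rule exchange_gain[where t = "real t" and d = "real i - real t" and e = "real j - real t"])
    show "3 \<le> real i - real t + (real j - real t)"
      using ij m by linarith
    show "fraction m i \<G> * (real t + (real i - real t) + (real j - real t)) \<le> real t + (real i - real t)"
      using fraction_le[OF \<G> ij(2) mn ne'(1)] m by simp
    show "fraction m j \<H> * (real t + (real i - real t) + (real j - real t)) \<le> real t + (real j - real t)"
      using fraction_le[OF \<H> ij(3) mn ne'(2)] m by simp
    show "growth m j \<le> growth m i" if "real j - real t \<le> real i - real t"
      using that ij by (intro growth_mono) auto
    show "growth m i \<le> growth m j" if "real i - real t \<le> real j - real t"
      using that ij ji by (intro growth_mono) auto
    show "real t - 1 \<le> growth m j" "real t - 1 \<le> growth m i"
      using growth_ge[OF ij(1-5)] growth_ge[OF ji ij(3,2,5,4)] by auto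
  qed (use t14 ij pos c_def in auto)
  then show ?thesis
  proof
    assume "1 + c / 2 * (fraction m i \<G> + growth m j * fraction m j \<H>)
        \<le> (1 - fraction m i \<G>) * (1 + growth m j * fraction m j \<H>)"
    then show ?thesis
      using stable_exchange_layers[OF \<G> \<H> _ ij(3) mn ne' _ stab1 c0 \<kappa>c] ij by simp
  next
    assume "1 + c / 2 * (fraction m j \<H> + growth m i * fraction m i \<G>)
        \<le> (1 - fraction m j \<H>) * (1 + growth m i * fraction m i \<G>)"
    then show ?thesis
      using stable_exchange_layers[OF \<H> \<G> _ ij(2) mn ne'(2,1) _ _ c0 \<kappa>c] stab2 ij
      by (simp add: stable_commute)
  qed
qed

text \<open>Members of \<open>\<H>\<close> contain every \<open>t\<close>-set of
  \<open>\<G>\<close>, in particular a critical one and all its shifts moving \<open>m\<close>, so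
  they equal \<open>{1..m}\<close> and \<open>Y = 1\<close>. Now \<open>X \<le> t / (t + 1)\<close>,
  hence \<open>(1 - X) * (1 + r) \<ge> (1 + r) / (t + 1)\<close>, which exceeds 1 because the
  density condition gives \<open>r \<ge> t + \<delta>\<close>.\<close>

lemma extreme_step:
  assumes \<G>: "shifted_upset m \<G>" and \<H>: "shifted_upset m \<H>"
    and cross: "cross_intersecting t \<G> \<H>" and m: "t < m" "m \<le> k"
    and ne: "critical_at m t \<G> \<noteq> {}" "layer n k m (critical_at m m \<H>) \<noteq> {}"
    and stab: "stable \<kappa> \<F> (layer n k m (\<G> - critical_at m t \<G>)) (layer n k m (lower m m \<H>))"
  shows "stable \<kappa> \<F> (layer n k m \<G>) (layer n k m \<H>)"
proof (cases "layer n k m \<G> = {}")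
  case True
  then show ?thesis
    using \<kappa>6 by (intro stable_if_product_le \<kappa>0) auto
next
  case False
  obtain E where E: "E \<in> \<G>" "m \<in> E" "card E = t"
    using ne(1) by (auto simp: critical_at_def critical_def)
  have finE: "finite E"
    using E(1) shifted_upset_subset[OF \<G>] finite_subset by blast
  have full: "F = {1..m}" if F: "F \<in> \<H>" for F
  proof -
    have sub: "E' \<subseteq> F" if "E' \<in> \<G>" "card E' = t" "finite E'" for E'
    proof -
      have "card E' \<le> card (E' \<inter> F)"
        using that F cross by (auto simp: cross_intersecting_def)
      then have "E' \<inter> F = E'"
        using that by (intro card_seteq) auto
      then show ?thesis by auto
    qed
    have "l \<in> F" if l: "l \<in> {1..m}" for l
    proof (cases "l \<in> E")
      case True
      then show ?thesis
        using sub[of E] E finE by auto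
    next
      case False
      then have "l < m"
        using l E(2) by (cases "l = m") auto
      then have "insert l (E - {m}) \<in> \<G>"
        using l False E by (intro shifted_upset_shift[OF \<G>]) auto
      then show ?thesis
        using sub[of "insert l (E - {m})"] card_shift[OF finE E(2) False] E(3) finE by auto
    qed
    then show ?thesis
      using shifted_upset_subset[OF \<H> F] by auto
  qed
  obtain F where "F \<in> critical_at m m \<H>"
    using ne(2) by (auto simp: layer_def)
  then have "critical_at m m \<H> = \<H>"
    using full critical_at_subset[of m m \<H>] by blast
  then have Y: "fraction m m \<H> = 1"
    using ne(2) by (simp add: fraction_def card_gt_0_iff)
  have neH: "layer n k m \<H> \<noteq> {}"
    using ne(2) layer_mono[OF critical_at_subset] by blast
  have mn: "m \<le> n"
    using m n_ge_15 by linarith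
  define r where "r = growth m m"
  define X where "X = fraction m t \<G>"
  have "X * real m \<le> real t"
    unfolding X_def using fraction_le[OF \<G> tk mn False] .
  have X0: "0 \<le> X"
    by (simp add: X_def fraction_def)
  have X: "X * (real t + 1) \<le> real t"
  proof -
    have "X * (real t + 1) \<le> X * real m"
      using m X0 by (intro mult_left_mono) auto
    then show ?thesis
      using \<open>X * real m \<le> real t\<close> by linarith
  qed
  have r: "real t + \<delta> \<le> r"
  proof -
    have "(real t + \<delta>) * (real k - real m + 1) \<le> (real t + \<delta>) * real k"
      using m t14 \<delta> by (intro mult_left_mono) auto
    also have "\<dots> = (real t + 1 + \<delta>) * real k - real k"
      by (simp add: algebra_simps)
    also have "\<dots> \<le> real n - real k - (real t - real t)"
      using n_ge by simp
    finally show ?thesis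
      unfolding r_def using growth_eq[of m t m] m tk by (simp add: pos_le_divide_eq)
  qed
  \<comment> \<open>From \<open>r \<ge> t + \<delta>\<close> follows
    \<open>r - t \<ge> r * \<delta> / (t + \<delta>)\<close>. The constant makes
    \<open>c * (2 * r)\<close> the \<open>(t + 1)\<close>-th part of the right side; the 2 covers
    \<open>X \<le> 1 \<le> r\<close>.\<close>
  define c where "c = \<delta> / (2 * (real t + 1) * (real t + \<delta>))"
  have c0: "0 \<le> c"
    using \<delta> by (simp add: c_def)
  have "1 + c * (X + r) \<le> (1 - X) * (1 + r)"
  proof -
    have "X \<le> real t / (real t + 1)"
      using X by (simp add: pos_le_divide_eq)
    also have "\<dots> \<le> 1"
      by simp
    finally have "c * (X + r) \<le> c * (2 * r)"
      using r t14 \<delta> c0 by (intro mult_left_mono) auto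
    also have "\<dots> = (r * (\<delta> / (real t + \<delta>))) / (real t + 1)"
    proof -
      have "\<delta> / (2 * u * v) * (2 * r) = (r * (\<delta> / v)) / u" for u v
        by (simp add: mult.commute)
      then show ?thesis
        by (simp only: c_def)
    qed
    also have "r * (\<delta> / (real t + \<delta>)) = r - real t * (r / (real t + \<delta>))"
      using \<delta> t14 by (simp add: field_simps)
    also have "\<dots> \<le> r - real t * 1"
      using r \<delta> t14 by (intro diff_left_mono mult_left_mono) (auto simp: divide_simps)
    finally have "1 + c * (X + r) \<le> 1 + (r - real t) / (real t + 1)"
      by (simp add: divide_right_mono)
    also have "\<dots> = (1 / (real t + 1)) * (1 + r)"
      by (simp add: field_simps)
    also have "\<dots> \<le> (1 - X) * (1 + r)"
      using X r t14 \<delta> by (intro mult_right_mono) (auto simp: field_simps)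
    finally show ?thesis .
  qed
  then show ?thesis
    using stable_exchange_layers[OF \<G> \<H> _ m(2) mn False neH _ stab c0] \<kappa>_extreme m
    by (simp add: X_def r_def c_def Y)
qed

text \<open>If one of the critical layers is empty, a suitable exchange only enlarges the other
  family and \<open>stable_enlarge\<close> applies. Otherwise cross intersection forces
  \<open>i\<close> and \<open>j\<close> to be at least \<open>t\<close>, nonempty layers force them
  to be at most \<open>k\<close>, and the three kinds of steps cover all cases.\<close>

lemma exchange_step:
  assumes \<G>: "shifted_upset m \<G>" and \<H>: "shifted_upset m \<H>"
    and cross: "cross_intersecting t \<G> \<H>" and m: "t < m" and ij: "i + j = m + t"
    and stab1: "stable \<kappa> \<F> (layer n k m (\<G> - critical_at m i \<G>)) (layer n k m (lower m j \<H>))"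
    and stab2: "stable \<kappa> \<F> (layer n k m (lower m i \<G>)) (layer n k m (\<H> - critical_at m j \<H>))"
  shows "stable \<kappa> \<F> (layer n k m \<G>) (layer n k m \<H>)"
proof -
  have cross': "cross_intersecting t \<H> \<G>"
    using cross by (simp add: cross_intersecting_commute)
  have stab2': "stable \<kappa> \<F> (layer n k m (\<H> - critical_at m j \<H>)) (layer n k m (lower m i \<G>))"
    using stab2 by (simp add: stable_commute)
  have lower: "layer n k m \<S> \<subseteq> layer n k m (lower m l \<S>)" for l \<S>
    by (intro layer_mono) (auto simp: lower_def)
  consider "layer n k m (critical_at m i \<G>) = {}" | "layer n k m (critical_at m j \<H>) = {}"
    | "layer n k m (critical_at m i \<G>) \<noteq> {}" "layer n k m (critical_at m j \<H>) \<noteq> {}"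
    by blast
  then show ?thesis
  proof cases
    case 1
    then have "layer n k m (\<G> - critical_at m i \<G>) = layer n k m \<G>"
      by (simp add: layer_Diff)
    then show ?thesis
      using stable_enlarge[OF _ _ finite_\<F> lower \<F>_nonempty _ \<kappa>0 \<kappa>6] stab1 by simp
  next
    case 2
    then have "layer n k m (\<H> - critical_at m j \<H>) = layer n k m \<H>"
      by (simp add: layer_Diff)
    then have "stable \<kappa> \<F> (layer n k m \<H>) (layer n k m \<G>)"
      using stable_enlarge[OF _ _ finite_\<F> lower \<F>_nonempty _ \<kappa>0 \<kappa>6] stab2' by simp
    then show ?thesis
      by (simp add: stable_commute)
  next
    case 3
    obtain E where E: "E \<in> critical_at m i \<G>"
      using 3(1) by (auto simp: layer_def)
    obtain F where F: "F \<in> critical_at m j \<H>"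
      using 3(2) by (auto simp: layer_def)
    have EF: "E \<in> \<G>" "F \<in> \<H>" "card E = i" "card F = j"
      using E F by (auto simp: critical_at_def critical_def)
    have fin: "finite E" "finite F"
      using finite_subset[OF shifted_upset_subset[OF \<G> EF(1)]]
        finite_subset[OF shifted_upset_subset[OF \<H> EF(2)]] by simp_all
    have "t \<le> card (E \<inter> F)"
      using cross EF by (auto simp: cross_intersecting_def)
    moreover have "card (E \<inter> F) \<le> i" "card (E \<inter> F) \<le> j"
      using card_mono[OF fin(1), of "E \<inter> F"] card_mono[OF fin(2), of "E \<inter> F"] EF by auto
    ultimately have tij: "t \<le> i" "t \<le> j"
      by auto
    have ik: "i \<le> k"
      using layer_uniform_empty[of "critical_at m i \<G>" i k n m] 3(1)
      by (force simp: critical_at_def)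
    have jk: "j \<le> k"
      using layer_uniform_empty[of "critical_at m j \<H>" j k n m] 3(2)
      by (force simp: critical_at_def)
    consider "i = t" | "j = t" | "i = t + 1" "j = t + 1" | "t < i" "t < j" "t + 2 < m"
      using tij ij by linarith
    then show ?thesis
    proof cases
      case 1
      then have "j = m"
        using ij by simp
      then show ?thesis
        using extreme_step[OF \<G> \<H> cross m] 1 3 E jk stab1 by auto
    next
      case 2
      then have "i = m"
        using ij by simp
      then have "stable \<kappa> \<F> (layer n k m \<H>) (layer n k m \<G>)"
        using extreme_step[OF \<H> \<G> cross' m] 2 3 F ik stab2' by auto
      then show ?thesis
        by (simp add: stable_commute)
    next
      case 3
      then have "m = t + 2" "t < k"
        using ij ik by auto
      then show ?thesis
        using middle_product[of \<G> \<H> E F] \<G> \<H> cross E F 3 card_\<F>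
        by (intro stable_if_product_le \<kappa>0) simp
    next
      case 4
      then show ?thesis
        using generic_step[OF \<G> \<H> ij ik jk _ _ _ 3 stab1 stab2] by simp
    qed
  qed
qed

section \<open>Induction on the length of the prefix\<close>

lemma stable_full_stars:
  assumes \<G>: "shifted_upset t \<G>" and \<H>: "shifted_upset t \<H>" and cross: "cross_intersecting t \<G> \<H>"
  shows "stable \<kappa> \<F> (layer n k t \<G>) (layer n k t \<H>)"
proof (cases "\<G> = {} \<or> \<H> = {}")
  case True
  then have "layer n k t \<G> = {} \<or> layer n k t \<H> = {}"
    by (auto simp: layer_def)
  then show ?thesis
    using \<kappa>6 by (intro stable_if_product_le \<kappa>0) auto
next
  case False
  have full: "E = {1..t} \<and> F = {1..t}" if "E \<in> \<G>" "F \<in> \<H>" for E F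
  proof -
    have "E \<subseteq> {1..t}" "F \<subseteq> {1..t}" "t \<le> card (E \<inter> F)"
      using that shifted_upset_subset[OF \<G>] shifted_upset_subset[OF \<H>] cross
      by (auto simp: cross_intersecting_def)
    then have "E \<inter> F = {1..t}"
      by (intro card_seteq) auto
    then show ?thesis
      using \<open>E \<subseteq> {1..t}\<close> \<open>F \<subseteq> {1..t}\<close> by blast
  qed
  obtain E F where "E \<in> \<G>" "F \<in> \<H>"
    using False by blast
  then have "\<G> = {{1..t}}" "\<H> = {{1..t}}"
    using full by blast+
  then show ?thesis
    by (simp add: F0_eq_layer stable_def power2_eq_square)
qed

text \<open>Without critical sets, removing \<open>Suc p\<close> from a member leaves a member;
  adding it always does. So the trace on \<open>{1..p}\<close> decides membership.\<close>

lemma restrict_noncritical: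
  assumes \<G>: "shifted_upset (Suc p) \<G>" and crit: "critical (Suc p) \<G> = {}"
  shows "shifted_upset p (\<G> \<inter> Pow {1..p})" "layer n k (Suc p) \<G> = layer n k p (\<G> \<inter> Pow {1..p})"
proof -
  show "shifted_upset p (\<G> \<inter> Pow {1..p})"
  proof (rule shifted_upsetI)
    show "insert i (E - {j}) \<in> \<G> \<inter> Pow {1..p}"
      if "E \<in> \<G> \<inter> Pow {1..p}" "j \<in> E" "i \<notin> E" "1 \<le> i" "i < j" for E i j
      using that shifted_upset_shift[OF \<G>, of E j i] by auto
    show "F \<in> \<G> \<inter> Pow {1..p}" if "E \<in> \<G> \<inter> Pow {1..p}" "E \<subseteq> F" "F \<subseteq> {1..p}" for E F
      using that shifted_upset_superset[OF \<G>, of E F] order_trans[of F "{1..p}" "{1..Suc p}"] by simp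
  qed auto
  have "A \<inter> {1..Suc p} \<in> \<G> \<longleftrightarrow> A \<inter> {1..p} \<in> \<G>" for A
  proof
    assume A: "A \<inter> {1..Suc p} \<in> \<G>"
    show "A \<inter> {1..p} \<in> \<G>"
    proof (cases "Suc p \<in> A")
      case True
      then have "A \<inter> {1..Suc p} - {Suc p} \<in> \<G>"
        using A crit by (auto simp: critical_def)
      moreover have "A \<inter> {1..Suc p} - {Suc p} = A \<inter> {1..p}"
        by auto
      ultimately show ?thesis by simp
    next
      case False
      then have "A \<inter> {1..Suc p} = A \<inter> {1..p}"
        by (auto simp: le_Suc_eq)
      then show ?thesis
        using A by simp
    qed
  next
    assume "A \<inter> {1..p} \<in> \<G>"
    then show "A \<inter> {1..Suc p} \<in> \<G>"
      by (rule shifted_upset_superset[OF \<G>]) auto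
  qed
  then show "layer n k (Suc p) \<G> = layer n k p (\<G> \<inter> Pow {1..p})"
    by (simp add: layer_def)
qed

lemma critical_at_exhaust:
  assumes "critical m \<G> \<noteq> {}" "shifted_upset m \<G>"
  obtains i where "i \<le> m" "critical_at m i \<G> \<noteq> {}"
proof -
  obtain E where E: "E \<in> critical m \<G>"
    using assms by auto
  then have "card E \<le> m"
    using shifted_upset_subset[OF assms(2), of E] card_mono[of "{1..m}" E] by (auto simp: critical_def)
  moreover have "E \<in> critical_at m (card E) \<G>"
    using E by (simp add: critical_at_def)
  ultimately show ?thesis
    using that by blast
qed

text \<open>Outer induction on \<open>m\<close>, inner induction on the number of critical sets.
  Both exchanges at a pair of sizes where a critical set occurs lower this number, so both resulting
  pairs are stable and \<open>exchange_step\<close> may use whichever gains.\<close>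

lemma stable_layers:
  assumes "t \<le> m" "shifted_upset m \<G>" "shifted_upset m \<H>" "cross_intersecting t \<G> \<H>"
  shows "stable \<kappa> \<F> (layer n k m \<G>) (layer n k m \<H>)"
  using assms
proof (induction m arbitrary: \<G> \<H> rule: nat_induct_at_least)
  case base
  then show ?case
    by (rule stable_full_stars)
next
  case (Suc p)
  define m where "m = Suc p"
  have "stable \<kappa> \<F> (layer n k m \<G>) (layer n k m \<H>)"
    if "shifted_upset m \<G>" "shifted_upset m \<H>" "cross_intersecting t \<G> \<H>" for \<G> \<H>
    using that
  proof (induction "card (critical m \<G>) + card (critical m \<H>)" arbitrary: \<G> \<H> rule: less_induct)
    case less
    note \<G> = less.prems(1) and \<H> = less.prems(2) and cross = less.prems(3)
    show ?case
    proof (cases "critical m \<G> = {} \<and> critical m \<H> = {}")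
      case True
      have "cross_intersecting t (\<G> \<inter> Pow {1..p}) (\<H> \<inter> Pow {1..p})"
        using cross by (auto simp: cross_intersecting_def)
      then show ?thesis
        using Suc.IH restrict_noncritical[of p \<G>] restrict_noncritical[of p \<H>] \<G> \<H> True
        by (simp add: m_def)
    next
      case False
      \<comment> \<open>A critical set has at most \<open>m\<close> elements, so the complementary
        size is not affected by truncated subtraction.\<close>
      have "\<exists>i j. i + j = m + t \<and> (critical_at m i \<G> \<noteq> {} \<or> critical_at m j \<H> \<noteq> {})"
      proof (cases "critical m \<G> = {}")
        case True
        then obtain j where "j \<le> m" "critical_at m j \<H> \<noteq> {}"
          using False critical_at_exhaust[OF _ \<H>] by blast
        then show ?thesis
          by (intro exI[of _ "m + t - j"] exI[of _ j]) simp
      next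
        case False
        then obtain i where "i \<le> m" "critical_at m i \<G> \<noteq> {}"
          using critical_at_exhaust[OF _ \<G>] by blast
        then show ?thesis
          by (intro exI[of _ i] exI[of _ "m + t - i"]) simp
      qed
      then obtain i j where ij: "i + j = m + t" and
        ne: "critical_at m i \<G> \<noteq> {} \<or> critical_at m j \<H> \<noteq> {}"
        by blast
      have fin: "finite (critical m \<G>)" "finite (critical m \<H>)"
        using shifted_upset_finite[OF \<G>] shifted_upset_finite[OF \<H>] by (auto simp: critical_def)
      have sub: "critical_at m l \<S> \<subseteq> critical m \<S>" for l \<S>
        by (auto simp: critical_at_def)
      have le: "card (critical m \<G> - critical_at m i \<G>) \<le> card (critical m \<G>)"
        "card (critical m \<H> - critical_at m j \<H>) \<le> card (critical m \<H>)"
        using fin by (auto intro: card_mono)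
      have lt: "card (critical m \<G> - critical_at m i \<G>) + card (critical m \<H> - critical_at m j \<H>)
          < card (critical m \<G>) + card (critical m \<H>)"
        using ne
      proof
        assume "critical_at m i \<G> \<noteq> {}"
        then have "card (critical m \<G> - critical_at m i \<G>) < card (critical m \<G>)"
          using fin sub[of i \<G>] by (intro psubset_card_mono) auto
        then show ?thesis
          using le by linarith
      next
        assume "critical_at m j \<H> \<noteq> {}"
        then have "card (critical m \<H> - critical_at m j \<H>) < card (critical m \<H>)"
          using fin sub[of j \<H>] by (intro psubset_card_mono) auto
        then show ?thesis
          using le by linarith
      qed
      have ji: "j + i = m + t"
        using ij by simp
      have cross': "cross_intersecting t \<H> \<G>"
        using cross by (simp add: cross_intersecting_commute)
      have "cross_intersecting t (lower m i \<G>) (\<H> - critical_at m j \<H>)"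
        using cross_intersecting_exchange[OF \<H> \<G> cross' ji] by (simp add: cross_intersecting_commute)
      then have "stable \<kappa> \<F> (layer n k m (lower m i \<G>)) (layer n k m (\<H> - critical_at m j \<H>))"
        using less.hyps[of "lower m i \<G>" "\<H> - critical_at m j \<H>"] lt
          shifted_upset_lower[OF \<G>] shifted_upset_remove[OF \<H>]
        by (simp add: critical_remove critical_lower)
      moreover have "stable \<kappa> \<F> (layer n k m (\<G> - critical_at m i \<G>)) (layer n k m (lower m j \<H>))"
        using less.hyps[of "\<G> - critical_at m i \<G>" "lower m j \<H>"] lt
          shifted_upset_lower[OF \<H>] shifted_upset_remove[OF \<G>]
          cross_intersecting_exchange[OF \<G> \<H> cross ij]
        by (simp add: critical_remove critical_lower)
      moreover have "t < m"
        using Suc.hyps by (simp add: m_def)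
      ultimately show ?thesis
        using exchange_step[OF \<G> \<H> cross _ ij] by blast
    qed
  qed
  then show ?case
    using Suc.prems by (simp add: m_def)
qed

section \<open>From families of \<open>k\<close>-sets to up-sets on a prefix\<close>

lemma cross_intersecting_prefix:
  assumes \<A>: "\<A> \<subseteq> nsets {1..n} k" "shifted n \<A>" and \<B>: "\<B> \<subseteq> nsets {1..n} k"
    and cross: "cross_intersecting t \<A> \<B>" and "A \<in> \<A>" "B \<in> \<B>"
  shows "t \<le> card (A \<inter> B \<inter> {1..2 * k - t})"
  using \<open>A \<in> \<A>\<close>
\<comment> \<open>Induction on the common elements beyond the prefix. The union of \<open>A\<close>
  and \<open>B\<close> has at most \<open>2 * k - t\<close> elements, so if such an \<open>l\<close>
  exists the union misses some \<open>x\<close> in the prefix. Shifting \<open>l\<close> to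
  \<open>x\<close> in \<open>A\<close> removes \<open>l\<close> from the intersection and leaves its
  part in the prefix unchanged.\<close>
proof (induction "card (A \<inter> B - {1..2 * k - t})" arbitrary: A)
  case 0
  have "finite (A \<inter> B)"
    using 0 \<A> by (auto simp: nsets_def)
  then have "A \<inter> B - {1..2 * k - t} = {}"
    using 0 by simp
  then have "A \<inter> B \<inter> {1..2 * k - t} = A \<inter> B"
    by blast
  then show ?case
    using cross 0 \<open>B \<in> \<B>\<close> by (simp add: cross_intersecting_def)
next
  case (Suc c)
  let ?P = "{1..2 * k - t}"
  have A: "A \<subseteq> {1..n}" "finite A" "card A = k"
    using Suc.prems \<A> by (auto simp: nsets_def)
  have B: "B \<subseteq> {1..n}" "finite B" "card B = k"
    using \<open>B \<in> \<B>\<close> \<B> by (auto simp: nsets_def)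
  have "A \<inter> B - ?P \<noteq> {}"
    using Suc.hyps(2) by (metis card.empty nat.distinct(1))
  then obtain l where l: "l \<in> A" "l \<in> B" "l \<notin> ?P"
    by blast
  have l1: "2 * k - t < l"
    using l A by auto
  have "card (A \<union> B) + card (A \<inter> B) = 2 * k"
    using card_Un_Int[OF A(2) B(2)] A B by simp
  moreover have "t \<le> card (A \<inter> B)"
    using cross Suc.prems \<open>B \<in> \<B>\<close> by (auto simp: cross_intersecting_def)
  moreover have "card ((A \<union> B) \<inter> ?P) < card (A \<union> B)"
    using A B l by (intro psubset_card_mono) auto
  ultimately have "card ((A \<union> B) \<inter> ?P) < card ?P"
    by simp
  then have "\<not> ?P \<subseteq> A \<union> B"
    by (metis Int_absorb1 less_irrefl)
  then obtain x where x: "x \<in> ?P" "x \<notin> A" "x \<notin> B"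
    by blast
  let ?A = "insert x (A - {l})"
  have "?A \<in> \<A>"
    using x l l1 Suc.prems by (intro shiftedD[OF \<A>(2)]) auto
  moreover have "?A \<inter> B - ?P = (A \<inter> B - ?P) - {l}"
    using x by auto
  then have "c = card (?A \<inter> B - ?P)"
    using Suc.hyps(2) l A by simp
  ultimately have "t \<le> card (?A \<inter> B \<inter> ?P)"
    using Suc.hyps(1) by blast
  also have "?A \<inter> B \<inter> ?P = A \<inter> B \<inter> ?P"
    using x l by auto
  finally show ?case .
qed

lemma shifted_upset_generated:
  assumes "shifted n \<A>"
  shows "shifted_upset m {E. E \<subseteq> {1..m} \<and> (\<exists>A\<in>\<A>. A \<inter> {1..m} \<subseteq> E)}"
proof (rule shifted_upsetI)
  fix E i j
  assume E: "E \<in> {E. E \<subseteq> {1..m} \<and> (\<exists>A\<in>\<A>. A \<inter> {1..m} \<subseteq> E)}"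
    and ij: "j \<in> E" "i \<notin> E" "1 \<le> i" "i < j"
  then obtain A where A: "A \<in> \<A>" "A \<inter> {1..m} \<subseteq> E" "E \<subseteq> {1..m}"
    by blast
  then have im: "i \<in> {1..m}"
    using ij by auto
  then have "i \<notin> A"
    using A ij by auto
  have "\<exists>A'\<in>\<A>. A' \<inter> {1..m} \<subseteq> insert i (E - {j})"
  \<comment> \<open>If \<open>A\<close> contains \<open>j\<close>, the shifted \<open>A\<close>
    generates the new set; otherwise the trace of \<open>A\<close> already avoids
    \<open>j\<close>.\<close>
  proof (cases "j \<in> A")
    case True
    then have "insert i (A - {j}) \<in> \<A>"
      using A ij \<open>i \<notin> A\<close> by (intro shiftedD[OF assms])
    moreover have "insert i (A - {j}) \<inter> {1..m} \<subseteq> insert i (E - {j})"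
      using A by auto
    ultimately show ?thesis
      by blast
  next
    case False
    then have "A \<inter> {1..m} \<subseteq> insert i (E - {j})"
      using A by auto
    then show ?thesis
      using A by blast
  qed
  then show "insert i (E - {j}) \<in> {E. E \<subseteq> {1..m} \<and> (\<exists>A\<in>\<A>. A \<inter> {1..m} \<subseteq> E)}"
    using A im by auto
next
  fix E F
  assume "E \<in> {E. E \<subseteq> {1..m} \<and> (\<exists>A\<in>\<A>. A \<inter> {1..m} \<subseteq> E)}" "E \<subseteq> F" "F \<subseteq> {1..m}"
  then show "F \<in> {E. E \<subseteq> {1..m} \<and> (\<exists>A\<in>\<A>. A \<inter> {1..m} \<subseteq> E)}"
    by blast
qed simp

text \<open>Each family lies in the layer of the up-set generated by its traces on the prefix, and
  these up-sets are cross \<open>t\<close>-intersecting. Two uses of \<open>stable_enlarge\<close>,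
  one per family, carry stability back from the layers.\<close>

lemma stable_shifted_families:
  assumes \<A>: "\<A> \<subseteq> nsets {1..n} k" "shifted n \<A>" and \<B>: "\<B> \<subseteq> nsets {1..n} k" "shifted n \<B>"
    and cross: "cross_intersecting t \<A> \<B>"
  shows "stable \<kappa> \<F> \<A> \<B>"
proof -
  define m where "m = 2 * k - t"
  define gen where "gen = (\<lambda>\<S>. {E. E \<subseteq> {1..m} \<and> (\<exists>A\<in>\<S>. A \<inter> {1..m} \<subseteq> E)})"
  have sub: "\<S> \<subseteq> layer n k m (gen \<S>)" if "\<S> \<subseteq> nsets {1..n} k" for \<S>
    using that by (auto simp: layer_def gen_def)
  have "cross_intersecting t (gen \<A>) (gen \<B>)"
    unfolding cross_intersecting_def
  proof (intro ballI)
    fix E F assume "E \<in> gen \<A>" "F \<in> gen \<B>"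
    then obtain A B where AB: "A \<in> \<A>" "B \<in> \<B>" "A \<inter> {1..m} \<subseteq> E" "B \<inter> {1..m} \<subseteq> F" and "E \<subseteq> {1..m}"
      by (auto simp: gen_def)
    have "t \<le> card (A \<inter> B \<inter> {1..m})"
      using cross_intersecting_prefix[OF \<A> \<B>(1) cross AB(1,2)] by (simp add: m_def)
    also have "\<dots> \<le> card (E \<inter> F)"
      using AB \<open>E \<subseteq> {1..m}\<close> finite_subset[of E "{1..m}"] by (intro card_mono) auto
    finally show "t \<le> card (E \<inter> F)" .
  qed
  moreover have "shifted_upset m (gen \<A>)" "shifted_upset m (gen \<B>)"
    unfolding gen_def using shifted_upset_generated \<A>(2) \<B>(2) by auto
  moreover have "t \<le> m"
    using tk by (simp add: m_def)
  ultimately have "stable \<kappa> \<F> (layer n k m (gen \<A>)) (layer n k m (gen \<B>))"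
    by (intro stable_layers)
  then have "stable \<kappa> \<F> (layer n k m (gen \<A>)) \<B>"
    by (intro stable_enlarge[OF _ _ finite_\<F> sub[OF \<B>(1)] \<F>_nonempty _ \<kappa>0 \<kappa>6]) auto
  then have "stable \<kappa> \<F> \<B> (layer n k m (gen \<A>))"
    by (simp add: stable_commute)
  moreover have "finite \<B>"
    using finite_subset[OF sub[OF \<B>(1)]] by simp
  ultimately have "stable \<kappa> \<F> \<B> \<A>"
    by (intro stable_enlarge[OF _ _ finite_\<F> sub[OF \<A>(1)] \<F>_nonempty _ \<kappa>0 \<kappa>6]) auto
  then show ?thesis
    by (simp add: stable_commute)
qed

end

section \<open>Choice of constants and conclusion\<close>

theorem theorem1p2:
  shows "\<forall>t::nat. \<forall>\<delta>::real. t \<ge> 14 \<and> \<delta> > 0 \<longrightarrow>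
    (\<exists>\<gamma>::real. 0 < \<gamma> \<and> \<gamma> \<le> 1 \<and>
      (\<forall>(k::nat) (n::nat) (\<eta>::real) (\<A>::nat set set) (\<B>::nat set set).
         k \<ge> t \<and> real n \<ge> (real t + 1 + \<delta>) * real k \<and> 0 < \<eta> \<and> \<eta> \<le> 1 \<and>
         \<A> \<subseteq> nsets {1..n} k \<and> \<B> \<subseteq> nsets {1..n} k \<and>
         shifted n \<A> \<and> shifted n \<B> \<and> cross_intersecting t \<A> \<B> \<longrightarrow>
           sqrt (real (card \<A>) * real (card \<B>)) < (1 - \<gamma> * \<eta>) * real ((n - t) choose (k - t)) \<or>
           real (card (sym_diff \<A> (F0 t n k))) + real (card (sym_diff \<B> (F0 t n k)))
             < \<eta> * real ((n - t) choose (k - t))))"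
proof (intro allI impI)
  fix t :: nat and \<delta> :: real
  assume "t \<ge> 14 \<and> \<delta> > 0"
  then have t: "14 \<le> t" and \<delta>: "0 < \<delta>"
    by auto
  define c1 where "c1 = 1 / (800 * real t)"
  define c2 where "c2 = \<delta> / (2 * (real t + 1) * (real t + \<delta>)) / 4"
  \<comment> \<open>The terms serve \<open>stable_enlarge\<close>, the middle case
    \<open>m = t + 2\<close>, and \<open>stable_exchange\<close> with gain \<open>4 * c1\<close> in
    the generic and \<open>4 * c2\<close> in the extreme step.\<close>
  define \<kappa> where "\<kappa> = min (min (1 / 6) (\<delta> / (2 * (real t + 1 + \<delta>)))) (min (c1 / (1 + 2 * c1)) (c2 / (1 + 2 * c2)))"
  have "0 < c1" "0 < c2"
    using t \<delta> by (auto simp: c1_def c2_def add_pos_pos)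
  then have \<kappa>: "0 < \<kappa>"
    using \<delta> by (simp add: \<kappa>_def add_pos_pos add_nonneg_pos)
  have \<kappa>6: "\<kappa> \<le> 1 / 6" and \<kappa>_le: "\<kappa> \<le> \<delta> / (2 * (real t + 1 + \<delta>))"
    "\<kappa> \<le> c1 / (1 + 2 * c1)" "\<kappa> \<le> c2 / (1 + 2 * c2)"
    unfolding \<kappa>_def by linarith+
  show "\<exists>\<gamma>::real. 0 < \<gamma> \<and> \<gamma> \<le> 1 \<and>
      (\<forall>(k::nat) (n::nat) (\<eta>::real) (\<A>::nat set set) (\<B>::nat set set).
         k \<ge> t \<and> real n \<ge> (real t + 1 + \<delta>) * real k \<and> 0 < \<eta> \<and> \<eta> \<le> 1 \<and>
         \<A> \<subseteq> nsets {1..n} k \<and> \<B> \<subseteq> nsets {1..n} k \<and>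
         shifted n \<A> \<and> shifted n \<B> \<and> cross_intersecting t \<A> \<B> \<longrightarrow>
           sqrt (real (card \<A>) * real (card \<B>)) < (1 - \<gamma> * \<eta>) * real ((n - t) choose (k - t)) \<or>
           real (card (sym_diff \<A> (F0 t n k))) + real (card (sym_diff \<B> (F0 t n k)))
             < \<eta> * real ((n - t) choose (k - t)))"
  \<comment> \<open>One halving of \<open>\<kappa>\<close> passes from the product to its square
    root, as \<open>1 - x\<close> is at most the square of \<open>1 - x / 2\<close>; a second makes
    the inequality strict.\<close>
  proof (intro exI[of _ "\<kappa> / 4"] conjI allI impI)
    fix k n :: nat and \<eta> :: real and \<A> \<B> :: "nat set set"
    assume *: "k \<ge> t \<and> real n \<ge> (real t + 1 + \<delta>) * real k \<and> 0 < \<eta> \<and> \<eta> \<le> 1 \<and>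
         \<A> \<subseteq> nsets {1..n} k \<and> \<B> \<subseteq> nsets {1..n} k \<and>
         shifted n \<A> \<and> shifted n \<B> \<and> cross_intersecting t \<A> \<B>"
    interpret ekr_parameters t k n \<delta> \<kappa>
      by unfold_locales (use t \<delta> * \<kappa> \<kappa>6 \<kappa>_le[unfolded c1_def c2_def] in simp_all)
    define D where "D = real (card (sym_diff \<A> \<F>)) + real (card (sym_diff \<B> \<F>))"
    \<comment> \<open>When (ii) fails, the relative deviation is at least \<open>\<eta>\<close>, and
      by \<open>\<eta> \<le> 1\<close> so is its value capped at 1.\<close>
    have "sqrt (real (card \<A>) * real (card \<B>)) < (1 - \<kappa> / 4 * \<eta>) * M" if "\<eta> * M \<le> D"
    proof -
      have "stable \<kappa> \<F> \<A> \<B>"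
        using * by (intro stable_shifted_families) auto
      then have "real (card \<A>) * real (card \<B>) \<le> (1 - \<kappa> * min 1 (D / M)) * M\<^sup>2"
        by (simp add: stable_def D_def card_\<F>)
      also have "\<dots> \<le> (1 - \<kappa> * \<eta>) * M\<^sup>2"
        using that * \<kappa> M_pos by (intro mult_right_mono diff_left_mono mult_left_mono) (auto simp: field_simps)
      also have "\<dots> \<le> (1 - \<kappa> / 2 * \<eta>)\<^sup>2 * M\<^sup>2"
        using * \<kappa> by (intro mult_right_mono) (auto simp: power2_eq_square algebra_simps)
      finally have "real (card \<A>) * real (card \<B>) \<le> ((1 - \<kappa> / 2 * \<eta>) * M)\<^sup>2"
        by (simp add: power_mult_distrib)
      moreover have "\<kappa> * \<eta> \<le> 1 * 1"
        using * \<kappa> \<kappa>6 by (intro mult_mono) auto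
      then have "0 \<le> (1 - \<kappa> / 2 * \<eta>) * M"
        using M_pos by simp
      ultimately have "sqrt (real (card \<A>) * real (card \<B>)) \<le> (1 - \<kappa> / 2 * \<eta>) * M"
        by (intro real_le_lsqrt) auto
      also have "\<dots> < (1 - \<kappa> / 4 * \<eta>) * M"
        using * \<kappa> M_pos by (intro mult_strict_right_mono) auto
      finally show ?thesis .
    qed
    then show "sqrt (real (card \<A>) * real (card \<B>)) < (1 - \<kappa> / 4 * \<eta>) * M \<or>
      real (card (sym_diff \<A> \<F>)) + real (card (sym_diff \<B> \<F>)) < \<eta> * M"
      unfolding D_def by linarith
  qed (use \<kappa> \<kappa>6 in auto)
qed

end
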